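(* Let $1 \rightarrow Q_8 \rightarrow G' \stackrel{q}{\rightarrow} G \rightarrow 1$ be a short exact sequence of groups, where $Q_8$ is the quaternion group of order $8$. Let $d\geq 2$ be an integer and let $\alpha_i,\beta_i\in G$, $1\le i\le d$, be such that $\prod_{i=1}^d[\alpha_i,\beta_i]=1$. Then there is a family $\{a_i,b_i\}_{i=1}^d$ of elements of $G'$ such that $q(a_i)=\alpha_i$ and $q(b_i)=\beta_i$ for all $i$ and $\prod_{i=1}^d[a_i,b_i]=1$. Moreover, the number of such families $(a_1,b_1,\dots,a_d,b_d)$ is equal to $8^{2d-1}(N+\varepsilon\, 2^{2-2d})$ for some $N\in\{1,2,4\}$ and some sign $\varepsilon\in\{1,-1\}$.
   Context: $Q_8=\{\pm1,\pm i,\pm j,\pm k\}$ is the quaternion group. $[x,y]=xyx^{-1}y^{-1}$ denotes the commutator, and products over $i=1,\dots,d$ are taken in increasing order of $i$. The groups $G$ and $G'$ are arbitrary (not necessarily finite). *)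

theory Defs
  imports Complex_Main "HOL-Algebra.Coset"
begin

text \<open>Quaternions with integer coefficients: \<open>Quat a b c d\<close> stands for \<open>a + b i + c j + d k\<close>.\<close>

datatype quat = Quat int int int int

text \<open>Hamilton's product, determined by \<open>i\<^sup>2 = j\<^sup>2 = k\<^sup>2 = i j k = -1\<close>.\<close>

fun quat_mult :: "quat \<Rightarrow> quat \<Rightarrow> quat" where
  "quat_mult (Quat a b c d) (Quat a' b' c' d') =
     Quat (a * a' - b * b' - c * c' - d * d')
          (a * b' + b * a' + c * d' - d * c')
          (a * c' - b * d' + c * a' + d * b')
          (a * d' + b * c' - c * b' + d * a')"

definition Q8 :: "quat monoid" where
  "Q8 = \<lparr>carrier = {Quat 1 0 0 0, Quat (-1) 0 0 0, Quat 0 1 0 0, Quat 0 (-1) 0 0,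
                     Quat 0 0 1 0, Quat 0 0 (-1) 0, Quat 0 0 0 1, Quat 0 0 0 (-1)},
         mult = quat_mult, one = Quat 1 0 0 0\<rparr>"

lemma group_Q8: "group Q8"
proof (rule groupI)
  fix x y z assume "x \<in> carrier Q8" "y \<in> carrier Q8" "z \<in> carrier Q8"
  then show "x \<otimes>\<^bsub>Q8\<^esub> y \<otimes>\<^bsub>Q8\<^esub> z = x \<otimes>\<^bsub>Q8\<^esub> (y \<otimes>\<^bsub>Q8\<^esub> z)"
    by (cases x; cases y; cases z) (simp add: Q8_def algebra_simps)
qed (auto simp: Q8_def)

lemma order_Q8: "order Q8 = 8"
  by (simp add: order_def Q8_def)

definition commutator :: "('a, 'm) monoid_scheme \<Rightarrow> 'a \<Rightarrow> 'a \<Rightarrow> 'a" where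
  "commutator G x y = x \<otimes>\<^bsub>G\<^esub> y \<otimes>\<^bsub>G\<^esub> inv\<^bsub>G\<^esub> x \<otimes>\<^bsub>G\<^esub> inv\<^bsub>G\<^esub> y"

text \<open>The ordered product \<open>[a\<^sub>1, b\<^sub>1] [a\<^sub>2, b\<^sub>2] \<dots> [a\<^sub>d, b\<^sub>d]\<close>.\<close>

definition commutator_prod ::
    "('a, 'm) monoid_scheme \<Rightarrow> nat \<Rightarrow> (nat \<Rightarrow> 'a) \<Rightarrow> (nat \<Rightarrow> 'a) \<Rightarrow> 'a" where
  "commutator_prod G d a b =
     foldr (\<otimes>\<^bsub>G\<^esub>) (map (\<lambda>i. commutator G (a i) (b i)) [1..<Suc d]) \<one>\<^bsub>G\<^esub>"

text \<open>The library's \<open>exact_seq\<close> forces all groups to live on the same type, hence this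
  heterogeneous version of exactness of \<open>1 \<rightarrow> K \<rightarrow> H \<rightarrow> G \<rightarrow> 1\<close>.\<close>

definition short_exact ::
    "('k, 'l) monoid_scheme \<Rightarrow> ('k \<Rightarrow> 'h) \<Rightarrow> ('h, 'm) monoid_scheme \<Rightarrow> ('h \<Rightarrow> 'g)
      \<Rightarrow> ('g, 'n) monoid_scheme \<Rightarrow> bool" where
  "short_exact K f H q G \<longleftrightarrow>
     group K \<and> group H \<and> group G \<and> f \<in> mon K H \<and> q \<in> epi H G \<and> f ` carrier K = kernel H G q"

text \<open>The families are extensional functions on \<open>{1..d}\<close>, so that distinct elements of this set
  are distinct families and its cardinality is the number of families.\<close>

definition commutator_lifts ::
    "('h, 'm) monoid_scheme \<Rightarrow> ('h \<Rightarrow> 'g) \<Rightarrow> nat \<Rightarrow> (nat \<Rightarrow> 'g) \<Rightarrow> (nat \<Rightarrow> 'g)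
      \<Rightarrow> ((nat \<Rightarrow> 'h) \<times> (nat \<Rightarrow> 'h)) set" where
  "commutator_lifts H q d \<alpha> \<beta> =
     {(a, b). a \<in> {1..d} \<rightarrow>\<^sub>E carrier H \<and> b \<in> {1..d} \<rightarrow>\<^sub>E carrier H \<and>
              (\<forall>i\<in>{1..d}. q (a i) = \<alpha> i \<and> q (b i) = \<beta> i) \<and>
              commutator_prod H d a b = \<one>\<^bsub>H\<^esub>}"

end

theory Submission
  imports Defs "HOL-Algebra.Product_Groups"
begin

text \<open>Every automorphism of \<open>Q\<^sub>8\<close> is conjugation by a nonzero integer quaternion, so each lift
  \<open>g \<in> G'\<close> has an intertwiner \<open>r\<close> that acts on \<open>Q\<^sub>8\<close> as \<open>g\<close> does. Modulo inner automorphisms,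
  \<open>r\<close> can be taken in a fixed \<open>S\<^sub>3\<close> inside \<open>Aut(Q\<^sub>8) = S\<^sub>4\<close>. For base lifts \<open>a\<^sub>i, b\<^sub>i\<close> with
  intertwiners \<open>u\<^sub>i, t\<^sub>i\<close> of this kind, \<open>\<Prod>[a\<^sub>i, b\<^sub>i]\<close> lies in \<open>Q\<^sub>8\<close> and acts by an element of \<open>S\<^sub>3\<close>,
  hence is \<open>\<plusminus>1\<close>. All lifts are \<open>x\<^sub>i a\<^sub>i, y\<^sub>i b\<^sub>i\<close> with \<open>x\<^sub>i, y\<^sub>i \<in> Q\<^sub>8\<close>. If \<open>w(x, y) \<in> Q\<^sub>8\<close> denotes the
  resulting commutator product, then the same word in the quaternions \<open>x\<^sub>i u\<^sub>i, y\<^sub>i t\<^sub>i\<close> equals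
  \<open>m w(x, y)\<close> for a fixed integer \<open>m\<close> with \<open>\<bar>m\<bar> = \<Prod>\<bar>u\<^sub>i\<bar>\<^sup>2 \<bar>t\<^sub>i\<bar>\<^sup>2\<close>.

  Let \<open>n\<^sub>+\<close> and \<open>n\<^sub>-\<close> be the numbers of \<open>(x, y)\<close> with \<open>w(x, y) = 1\<close> and \<open>w(x, y) = -1\<close>. Modulo \<open>\<plusminus>1\<close> the map \<open>w\<close> is a
  homomorphism from \<open>Q\<^sub>8\<^bsup>2d\<^esup>\<close> to a group of order 4, so \<open>n\<^sub>+ + n\<^sub>- = 64\<^sup>d / k\<close> with \<open>k \<in> {1, 2, 4}\<close>.
  By Schur orthogonality the sum of \<open>m w(x, y)\<close> over all \<open>(x, y)\<close> is \<open>16\<^sup>d \<bar>m\<bar>\<close>, and taking real parts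
  gives \<open>n\<^sub>+ - n\<^sub>- = \<plusminus>16\<^sup>d\<close>. Solving for \<open>n\<^sub>+\<close> yields the formula with \<open>N = 4 / k\<close>, and \<open>n\<^sub>+ > 0\<close>.\<close>

section \<open>The ring of integer quaternions\<close>

instantiation quat :: ring_1
begin

definition zero_quat :: quat where
  "0 = Quat 0 0 0 0"

definition one_quat :: quat where
  "1 = Quat 1 0 0 0"

fun plus_quat :: "quat \<Rightarrow> quat \<Rightarrow> quat" where
  "Quat a b c d + Quat a' b' c' d' = Quat (a + a') (b + b') (c + c') (d + d')"

fun minus_quat :: "quat \<Rightarrow> quat \<Rightarrow> quat" where
  "Quat a b c d - Quat a' b' c' d' = Quat (a - a') (b - b') (c - c') (d - d')"

fun uminus_quat :: "quat \<Rightarrow> quat" where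
  "- Quat a b c d = Quat (- a) (- b) (- c) (- d)"

definition times_quat :: "quat \<Rightarrow> quat \<Rightarrow> quat" where
  "x * y = quat_mult x y"

instance
proof
  fix a b c :: quat
  show "a * b * c = a * (b * c)"
    by (cases a; cases b; cases c) (simp add: times_quat_def algebra_simps)
  show "a + b + c = a + (b + c)" "a + b = b + a" "a - b = a + - b"
    by (cases a; cases b; cases c; simp)+
  show "(a + b) * c = a * c + b * c" "a * (b + c) = a * b + a * c"
    by (cases a; cases b; cases c; simp add: times_quat_def algebra_simps)+
  show "1 * a = a" "a * 1 = a" "0 + a = a" "- a + a = 0"
    by (cases a; simp add: zero_quat_def one_quat_def times_quat_def)+
  show "(0::quat) \<noteq> 1"
    by (simp add: zero_quat_def one_quat_def)
qed

end

lemma Quat_times [simp]: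
  "Quat a b c d * Quat a' b' c' d' =
     Quat (a * a' - b * b' - c * c' - d * d') (a * b' + b * a' + c * d' - d * c')
          (a * c' - b * d' + c * a' + d * b') (a * d' + b * c' - c * b' + d * a')"
  by (simp add: times_quat_def)

lemma of_int_quat: "of_int n = Quat n 0 0 0"
proof -
  have *: "of_nat k = Quat (int k) 0 0 0" for k
    by (induction k) (simp_all add: zero_quat_def one_quat_def)
  show ?thesis
    by (cases n rule: int_cases2) (simp_all add: *)
qed

fun qcnj :: "quat \<Rightarrow> quat" where
  "qcnj (Quat a b c d) = Quat a (- b) (- c) (- d)"

fun qnorm :: "quat \<Rightarrow> int" where
  "qnorm (Quat a b c d) = a\<^sup>2 + b\<^sup>2 + c\<^sup>2 + d\<^sup>2"

fun qre :: "quat \<Rightarrow> int" where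
  "qre (Quat a b c d) = a"

lemma qcnj_mult: "qcnj (x * y) = qcnj y * qcnj x"
  by (cases x; cases y) (simp add: algebra_simps)

lemma mult_qcnj: "x * qcnj x = of_int (qnorm x)" and qcnj_mult_self: "qcnj x * x = of_int (qnorm x)"
  by (cases x; simp add: of_int_quat power2_eq_square)+

lemma qnorm_mult: "qnorm (x * y) = qnorm x * qnorm y"
  by (cases x; cases y) (simp add: algebra_simps power2_eq_square)

lemma qnorm_qcnj [simp]: "qnorm (qcnj x) = qnorm x"
  by (cases x) simp

lemma qnorm_nonneg: "qnorm x \<ge> 0"
  by (cases x) simp

lemma qnorm_eq_0_iff [simp]: "qnorm x = 0 \<longleftrightarrow> x = 0"
proof (cases x)
  case (Quat a b c d)
  have "a\<^sup>2 + b\<^sup>2 + c\<^sup>2 + d\<^sup>2 = 0 \<longleftrightarrow> a\<^sup>2 = 0 \<and> b\<^sup>2 = 0 \<and> c\<^sup>2 = 0 \<and> d\<^sup>2 = 0"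
    using zero_le_power2[of a] zero_le_power2[of b] zero_le_power2[of c] zero_le_power2[of d]
    by linarith
  then show ?thesis
    by (simp add: Quat zero_quat_def)
qed

text \<open>The norm is multiplicative and vanishes only at 0. Intertwiners and nonzero integer
  scalars can therefore be cancelled.\<close>

instance quat :: ring_1_no_zero_divisors
proof
  fix x y :: quat
  assume "x \<noteq> 0" "y \<noteq> 0"
  then have "qnorm (x * y) \<noteq> 0"
    unfolding qnorm_mult by simp
  then show "x * y \<noteq> 0"
    by simp
qed

lemma of_int_quat_eq_0_iff: "of_int n = (0::quat) \<longleftrightarrow> n = 0"
  by (simp add: of_int_quat zero_quat_def)

lemma qcnj_eq_0_iff [simp]: "qcnj x = 0 \<longleftrightarrow> x = 0"
  by (cases x) (auto simp: zero_quat_def)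

lemma qre_add: "qre (x + y) = qre x + qre y"
  by (cases x; cases y) simp

lemma qre_sum: "qre (sum h A) = (\<Sum>x\<in>A. qre (h x))"
proof (induction A rule: infinite_finite_induct)
qed (simp_all add: qre_add zero_quat_def)

lemma qre_of_int_mult: "qre (of_int n * x) = n * qre x"
  by (cases x) (simp add: of_int_quat)

text \<open>Conjugates replace inverses, so the expression stays integral. For nonzero arguments it
  is their commutator multiplied by \<open>qnorm u * qnorm t\<close>.\<close>

definition qcomm :: "quat \<Rightarrow> quat \<Rightarrow> quat" where
  "qcomm u t = u * t * qcnj u * qcnj t"

lemma qnorm_qcomm: "qnorm (qcomm u t) = (qnorm u * qnorm t)\<^sup>2"
  by (simp add: qcomm_def qnorm_mult power2_eq_square)

section \<open>The quaternion group inside the ring\<close>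

abbreviation Q :: "quat set" where
  "Q \<equiv> carrier Q8"

lemma mult_Q8 [simp]: "x \<otimes>\<^bsub>Q8\<^esub> y = x * y"
  by (simp add: Q8_def times_quat_def)

lemma one_Q8 [simp]: "\<one>\<^bsub>Q8\<^esub> = 1"
  by (simp add: Q8_def one_quat_def)

lemma carrier_Q8:
  "Q = {1, - 1, Quat 0 1 0 0, - Quat 0 1 0 0, Quat 0 0 1 0, - Quat 0 0 1 0,
        Quat 0 0 0 1, - Quat 0 0 0 1}"
  by (simp add: Q8_def one_quat_def)

lemma Q8_closed [intro]:
  shows Q8_mult: "x \<in> Q \<Longrightarrow> y \<in> Q \<Longrightarrow> x * y \<in> Q"
    and Q8_one: "1 \<in> Q"
    and Q8_uminus: "x \<in> Q \<Longrightarrow> - x \<in> Q"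
    and Q8_qcnj: "x \<in> Q \<Longrightarrow> qcnj x \<in> Q"
  by (auto simp: Q8_def one_quat_def)

lemma qnorm_Q8: "x \<in> Q \<Longrightarrow> qnorm x = 1"
  by (auto simp: Q8_def)

lemma Q8_nonzero: "x \<in> Q \<Longrightarrow> x \<noteq> 0"
  by (auto simp: Q8_def zero_quat_def)

lemma Q8_mult_qcnj: "x \<in> Q \<Longrightarrow> x * qcnj x = 1" "x \<in> Q \<Longrightarrow> qcnj x * x = 1"
  by (simp_all add: mult_qcnj qcnj_mult_self qnorm_Q8)

lemma Q8_commute_up_to_sign: "x \<in> Q \<Longrightarrow> y \<in> Q \<Longrightarrow> x * y = y * x \<or> x * y = - (y * x)"
  by (auto simp: Q8_def)

text \<open>This is half the character of the two-dimensional representation. Summing real parts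
  thus counts values 1 minus values -1.\<close>

lemma qre_Q8: "x \<in> Q \<Longrightarrow> qre x = of_bool (x = 1) - of_bool (x = - 1)"
  by (auto simp: Q8_def one_quat_def)

text \<open>The next two lemmas are Schur orthogonality for the two-dimensional representation of \<open>Q\<^sub>8\<close>.\<close>

lemma sum_Q8_conjugate: "(\<Sum>x\<in>Q. x * p * qcnj x) = of_int (8 * qre p)"
  by (cases p) (simp add: Q8_def of_int_quat)

lemma sum_Q8_trace: "(\<Sum>y\<in>Q. of_int (qre (y * t)) * qcnj (y * t)) = of_int (2 * qnorm t)"
  by (cases t) (simp add: Q8_def of_int_quat power2_eq_square algebra_simps)

lemma qre_conjugate: "qre (u * p * qcnj u) = qnorm u * qre p"
  by (cases u; cases p) (simp add: power2_eq_square algebra_simps)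

text \<open>The sum over \<open>x\<close> comes first: averaging the conjugates of
  \<open>u * (y * t) * qcnj u\<close> leaves 8 times its real part. The remaining sum over
  \<open>y\<close> is the second orthogonality relation, hence 16 = 8 * 2.\<close>

lemma sum_qcomm:
  "(\<Sum>(x, y)\<in>Q \<times> Q. qcomm (x * u) (y * t)) = of_int (16 * (qnorm u * qnorm t))"
proof -
  have "(\<Sum>(x, y)\<in>Q \<times> Q. qcomm (x * u) (y * t)) = (\<Sum>x\<in>Q. \<Sum>y\<in>Q. qcomm (x * u) (y * t))"
    by (rule sum.cartesian_product[symmetric])
  also have "\<dots> = (\<Sum>y\<in>Q. \<Sum>x\<in>Q. qcomm (x * u) (y * t))"
    by (rule sum.swap)
  also have "\<dots> = (\<Sum>y\<in>Q. (\<Sum>x\<in>Q. x * (u * (y * t) * qcnj u) * qcnj x) * qcnj (y * t))"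
    by (simp add: qcomm_def sum_distrib_right mult.assoc qcnj_mult)
  also have "\<dots> = (\<Sum>y\<in>Q. of_int (8 * qnorm u) * (of_int (qre (y * t)) * qcnj (y * t)))"
    unfolding sum_Q8_conjugate qre_conjugate by (simp add: mult.assoc)
  also have "\<dots> = of_int (8 * qnorm u) * of_int (2 * qnorm t)"
    by (simp only: sum_distrib_left[symmetric] sum_Q8_trace)
  finally show ?thesis
    by (simp only: of_int_mult[symmetric] mult.assoc mult.left_commute) simp
qed

text \<open>A form of Schur's lemma: commuting with i removes the j and k coordinates, commuting
  with j removes the i coordinate.\<close>

lemma commutes_with_Q8_imp_scalar:
  assumes "\<And>z. z \<in> Q \<Longrightarrow> r * z = z * r"
  shows "\<exists>m. r = of_int m"
proof (cases r)
  case (Quat a b c d)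
  show ?thesis
    using assms[of "Quat 0 1 0 0"] assms[of "Quat 0 0 1 0"]
    by (simp add: Quat Q8_def of_int_quat)
qed

text \<open>Projectively, the nonzero elements normalizing \<open>Q\<^sub>8\<close> form a copy of \<open>S\<^sub>3\<close>: they preserve the
  axis \<open>i + j + k\<close> up to sign. It meets the projective image of \<open>Q\<^sub>8\<close> trivially.\<close>

definition sym3 :: "quat set" where
  "sym3 = {Quat a b c d | a b c d. b = c \<and> c = d \<or> a = 0 \<and> b + c + d = 0}"

lemma Quat_mem_sym3 [simp]:
  "Quat a b c d \<in> sym3 \<longleftrightarrow> b = c \<and> c = d \<or> a = 0 \<and> b + c + d = 0"
  by (auto simp: sym3_def)

text \<open>Put v = i + j + k. Elements of \<open>sym3\<close> are either a + b v or pure and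
  orthogonal to v. Pure quaternions multiply as cross product minus inner product, so products are
  again of one of these two types.\<close>

lemma sym3_mult:
  assumes "x \<in> sym3" "y \<in> sym3"
  shows "x * y \<in> sym3"
proof (cases x; cases y)
  fix a b c d a' b' c' d'
  assume xy: "x = Quat a b c d" "y = Quat a' b' c' d'"
  have "a = 0 \<and> d = - b - c \<or> b = c \<and> d = c" "a' = 0 \<and> d' = - b' - c' \<or> b' = c' \<and> d' = c'"
    using assms by (auto simp: xy)
  then show ?thesis
    unfolding xy by (elim disjE conjE; hypsubst; simp add: algebra_simps)
qed

lemma sym3_one: "1 \<in> sym3"
  by (simp add: one_quat_def)

lemma sym3_qcnj: "x \<in> sym3 \<Longrightarrow> qcnj x \<in> sym3"
  by (cases x) auto

text \<open>For the other six elements the multiple has real part 0 and exactly one nonzero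
  imaginary coordinate, which violates both alternatives of \<open>sym3\<close>.\<close>

lemma sym3_Q8: "e \<in> Q \<Longrightarrow> m \<noteq> 0 \<Longrightarrow> of_int m * e \<in> sym3 \<Longrightarrow> e = 1 \<or> e = - 1"
  by (auto simp: Q8_def of_int_quat one_quat_def)

text \<open>Closure under products is enough because every element is a positive word in i and j: -1
  = i^2, -i = i^3, -j = i^2 j, k = i j, -k = j i, 1 = i^4.\<close>

lemma Q8_generated:
  assumes "\<And>x y. P x \<Longrightarrow> P y \<Longrightarrow> P (x * y)" "P (Quat 0 1 0 0)" "P (Quat 0 0 1 0)" "z \<in> Q"
  shows "P z"
proof -
  note m = assms(1) and i = assms(2) and j = assms(3)
  show ?thesis
    using assms(4) m[OF i i] m[OF m[OF i i] i] m[OF m[OF i i] j] m[OF i j] m[OF j i]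
      m[OF m[OF i i] m[OF i i]] i j
    by (auto simp: Q8_def)
qed


text \<open>The hypotheses make \<open>p\<close>, \<open>s\<close> and \<open>p * s\<close> elements
  of order 4, which leaves the 24 images of (i, j) under automorphisms. Four inner automorphisms
  times six outer representatives account for all of them; the check is by enumeration.\<close>

lemma Q8_automorphism_intertwiner:
  assumes "p \<in> Q" "s \<in> Q" "p * p \<noteq> 1" "s * s \<noteq> 1" "p * s * (p * s) \<noteq> 1"
  shows "\<exists>e\<in>Q. \<exists>u\<in>sym3 - {0}. e * p * qcnj e * u = u * Quat 0 1 0 0 \<and>
           e * s * qcnj e * u = u * Quat 0 0 1 0"
proof -
  \<comment> \<open>Representatives of \<open>Q8\<close> modulo signs, one for each inner
    automorphism.\<close>
  define E where "E = {Quat 1 0 0 0, Quat 0 1 0 0, Quat 0 0 1 0, Quat 0 0 0 1}"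
  \<comment> \<open>As rotations: the identity, the two turns of order 3 about i + j + k, and the
    half-turns about i - j, j - k and i - k.\<close>
  define U where "U = {Quat 1 0 0 0, Quat 1 1 1 1, Quat 1 (- 1) (- 1) (- 1), Quat 0 1 (- 1) 0,
    Quat 0 0 1 (- 1), Quat 0 1 0 (- 1)}"
  have "\<forall>p\<in>Q. \<forall>s\<in>Q. p * p \<noteq> 1 \<longrightarrow> s * s \<noteq> 1 \<longrightarrow> p * s * (p * s) \<noteq> 1 \<longrightarrow>
      (\<exists>e\<in>E. \<exists>u\<in>U. e * p * qcnj e * u = u * Quat 0 1 0 0 \<and> e * s * qcnj e * u = u * Quat 0 0 1 0)"
    by (simp add: Q8_def U_def E_def one_quat_def)
  moreover have "U \<subseteq> sym3 - {0}" "E \<subseteq> Q"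
    by (auto simp: U_def E_def Q8_def zero_quat_def)
  ultimately show ?thesis
    using assms by (meson subsetD)
qed


section \<open>Intertwiners\<close>

text \<open>\<open>qcnj r\<close> is a positive multiple of the inverse of \<open>r\<close>. Without
  division, the identity is first multiplied by \<open>r\<close> on the right, where the central
  integer \<open>qnorm r\<close> appears, and then \<open>r\<close> is cancelled.\<close>

lemma qcnj_intertwines:
  assumes "r \<noteq> 0" "r * z = z' * r"
  shows "qcnj r * z' = z * qcnj r"
proof -
  have "qcnj r * z' * r = z * qcnj r * r"
  proof -
    have "qcnj r * z' * r = qcnj r * r * z"
      by (simp add: assms(2) mult.assoc)
    also have "\<dots> = z * qcnj r * r"
      by (simp add: qcnj_mult_self mult_of_int_commute mult.assoc)
    finally show ?thesis .
  qed
  then show ?thesis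
    using assms(1) by simp
qed

text \<open>The relation \<open>r * z = z' * r\<close> expresses conjugation without dividing by
  \<open>r\<close>. Images and preimages are both demanded, so passing to \<open>qcnj r\<close>
  merely exchanges the two conditions.\<close>

definition Q8_normalizer :: "quat set" where
  "Q8_normalizer = {r. r \<noteq> 0 \<and> (\<forall>z\<in>Q. \<exists>z'\<in>Q. r * z = z' * r) \<and> (\<forall>z'\<in>Q. \<exists>z\<in>Q. r * z = z' * r)}"

lemma Q8_normalizerD:
  assumes "r \<in> Q8_normalizer"
  shows "r \<noteq> 0" "z \<in> Q \<Longrightarrow> \<exists>z'\<in>Q. r * z = z' * r" "z' \<in> Q \<Longrightarrow> \<exists>z\<in>Q. r * z = z' * r"
  using assms unfolding Q8_normalizer_def by blast+

lemma Q8_normalizer_qcnj: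
  assumes "r \<in> Q8_normalizer"
  shows "qcnj r \<in> Q8_normalizer"
proof -
  note r = Q8_normalizerD[OF assms]
  have "\<exists>z'\<in>Q. qcnj r * z = z' * qcnj r" if "z \<in> Q" for z
    using r(3)[OF that] qcnj_intertwines[OF r(1)] by blast
  moreover have "\<exists>z\<in>Q. qcnj r * z = z' * qcnj r" if "z' \<in> Q" for z'
    using r(2)[OF that] qcnj_intertwines[OF r(1)] by blast
  ultimately show ?thesis
    using r(1) unfolding Q8_normalizer_def by simp
qed

lemma Q8_normalizer_one: "1 \<in> Q8_normalizer"
  unfolding Q8_normalizer_def by auto

lemma Q8_normalizer_mult:
  assumes "r \<in> Q8_normalizer" "s \<in> Q8_normalizer"
  shows "r * s \<in> Q8_normalizer"
proof -
  note r = Q8_normalizerD[OF assms(1)] and s = Q8_normalizerD[OF assms(2)]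
  have *: "r * s * z = z'' * (r * s)" if "s * z = z' * s" "r * z' = z'' * r" for z z' z''
    using that by (metis mult.assoc)
  have "\<exists>z''\<in>Q. r * s * z = z'' * (r * s)" if "z \<in> Q" for z
    using s(2)[OF that] r(2) * by blast
  moreover have "\<exists>z\<in>Q. r * s * z = z'' * (r * s)" if "z'' \<in> Q" for z''
    using r(3)[OF that] s(3) * by blast
  ultimately show ?thesis
    using r(1) s(1) unfolding Q8_normalizer_def by simp
qed

text \<open>Modulo \<open>\<plusminus>1\<close> the group \<open>Q\<^sub>8\<close> is abelian, which makes the quadruples
  \<open>(r, e r, e' r, \<plusminus> e e' r)\<close> closed under products and inverses.\<close>

definition parallelogram :: "quat \<Rightarrow> quat \<Rightarrow> quat \<Rightarrow> quat \<Rightarrow> bool" where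
  "parallelogram r\<^sub>0 r\<^sub>1 r\<^sub>2 r\<^sub>3 \<longleftrightarrow> r\<^sub>0 \<in> Q8_normalizer \<and>
     (\<exists>e\<^sub>1\<in>Q. \<exists>e\<^sub>2\<in>Q. r\<^sub>1 = e\<^sub>1 * r\<^sub>0 \<and> r\<^sub>2 = e\<^sub>2 * r\<^sub>0 \<and> (r\<^sub>3 = e\<^sub>1 * e\<^sub>2 * r\<^sub>0 \<or> r\<^sub>3 = - (e\<^sub>1 * e\<^sub>2 * r\<^sub>0)))"

lemma parallelogram_one: "parallelogram 1 1 1 1"
  unfolding parallelogram_def using Q8_normalizer_one by auto

lemma parallelogram_mult:
  assumes "parallelogram r\<^sub>0 r\<^sub>1 r\<^sub>2 r\<^sub>3" "parallelogram s\<^sub>0 s\<^sub>1 s\<^sub>2 s\<^sub>3"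
  shows "parallelogram (r\<^sub>0 * s\<^sub>0) (r\<^sub>1 * s\<^sub>1) (r\<^sub>2 * s\<^sub>2) (r\<^sub>3 * s\<^sub>3)"
proof -
  obtain e\<^sub>1 e\<^sub>2 where e: "e\<^sub>1 \<in> Q" "e\<^sub>2 \<in> Q" "r\<^sub>1 = e\<^sub>1 * r\<^sub>0" "r\<^sub>2 = e\<^sub>2 * r\<^sub>0"
      "r\<^sub>3 = e\<^sub>1 * e\<^sub>2 * r\<^sub>0 \<or> r\<^sub>3 = - (e\<^sub>1 * e\<^sub>2 * r\<^sub>0)" and r0: "r\<^sub>0 \<in> Q8_normalizer"
    using assms(1) unfolding parallelogram_def by blast
  obtain d\<^sub>1 d\<^sub>2 where d: "d\<^sub>1 \<in> Q" "d\<^sub>2 \<in> Q" "s\<^sub>1 = d\<^sub>1 * s\<^sub>0" "s\<^sub>2 = d\<^sub>2 * s\<^sub>0"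
      "s\<^sub>3 = d\<^sub>1 * d\<^sub>2 * s\<^sub>0 \<or> s\<^sub>3 = - (d\<^sub>1 * d\<^sub>2 * s\<^sub>0)" and s0: "s\<^sub>0 \<in> Q8_normalizer"
    using assms(2) unfolding parallelogram_def by blast
  obtain c\<^sub>1 c\<^sub>2 where c: "c\<^sub>1 \<in> Q" "c\<^sub>2 \<in> Q" "r\<^sub>0 * d\<^sub>1 = c\<^sub>1 * r\<^sub>0" "r\<^sub>0 * d\<^sub>2 = c\<^sub>2 * r\<^sub>0"
    using Q8_normalizerD(2)[OF r0] d by meson
  have rd: "r\<^sub>0 * (d\<^sub>1 * x) = c\<^sub>1 * (r\<^sub>0 * x)" "r\<^sub>0 * (d\<^sub>2 * x) = c\<^sub>2 * (r\<^sub>0 * x)" for x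
    using c by (simp_all flip: mult.assoc)
  have "r\<^sub>3 * s\<^sub>3 = e\<^sub>1 * (e\<^sub>2 * c\<^sub>1) * c\<^sub>2 * (r\<^sub>0 * s\<^sub>0) \<or> r\<^sub>3 * s\<^sub>3 = - (e\<^sub>1 * (e\<^sub>2 * c\<^sub>1) * c\<^sub>2 * (r\<^sub>0 * s\<^sub>0))"
    using e(5) d(5) by (auto simp: mult.assoc rd)
  \<comment> \<open>Moving \<open>r\<^sub>0\<close> to the right produced the order e1 e2 c1 c2.
    Only e2 and c1 have to be swapped, at the cost of a sign.\<close>
  moreover have "e\<^sub>1 * (e\<^sub>2 * c\<^sub>1) * c\<^sub>2 * (r\<^sub>0 * s\<^sub>0) = (e\<^sub>1 * c\<^sub>1) * (e\<^sub>2 * c\<^sub>2) * (r\<^sub>0 * s\<^sub>0)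
      \<or> e\<^sub>1 * (e\<^sub>2 * c\<^sub>1) * c\<^sub>2 * (r\<^sub>0 * s\<^sub>0) = - ((e\<^sub>1 * c\<^sub>1) * (e\<^sub>2 * c\<^sub>2) * (r\<^sub>0 * s\<^sub>0))"
    using Q8_commute_up_to_sign[OF e(2) c(1)]
  proof
    assume eq: "e\<^sub>2 * c\<^sub>1 = c\<^sub>1 * e\<^sub>2"
    show ?thesis
      unfolding eq by (simp add: mult.assoc)
  next
    assume eq: "e\<^sub>2 * c\<^sub>1 = - (c\<^sub>1 * e\<^sub>2)"
    show ?thesis
      unfolding eq by (simp add: mult.assoc)
  qed
  ultimately have "r\<^sub>3 * s\<^sub>3 = (e\<^sub>1 * c\<^sub>1) * (e\<^sub>2 * c\<^sub>2) * (r\<^sub>0 * s\<^sub>0)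
      \<or> r\<^sub>3 * s\<^sub>3 = - ((e\<^sub>1 * c\<^sub>1) * (e\<^sub>2 * c\<^sub>2) * (r\<^sub>0 * s\<^sub>0))"
    by (metis minus_minus)
  moreover have "r\<^sub>1 * s\<^sub>1 = e\<^sub>1 * c\<^sub>1 * (r\<^sub>0 * s\<^sub>0)" "r\<^sub>2 * s\<^sub>2 = e\<^sub>2 * c\<^sub>2 * (r\<^sub>0 * s\<^sub>0)"
    by (simp_all add: e d rd mult.assoc)
  moreover have "e\<^sub>1 * c\<^sub>1 \<in> Q" "e\<^sub>2 * c\<^sub>2 \<in> Q"
    using e c by auto
  ultimately show ?thesis
    using Q8_normalizer_mult[OF r0 s0] unfolding parallelogram_def by blast
qed

lemma parallelogram_qcnj:
  assumes "parallelogram r\<^sub>0 r\<^sub>1 r\<^sub>2 r\<^sub>3"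
  shows "parallelogram (qcnj r\<^sub>0) (qcnj r\<^sub>1) (qcnj r\<^sub>2) (qcnj r\<^sub>3)"
proof -
  obtain e\<^sub>1 e\<^sub>2 where e: "e\<^sub>1 \<in> Q" "e\<^sub>2 \<in> Q" "r\<^sub>1 = e\<^sub>1 * r\<^sub>0" "r\<^sub>2 = e\<^sub>2 * r\<^sub>0"
      "r\<^sub>3 = e\<^sub>1 * e\<^sub>2 * r\<^sub>0 \<or> r\<^sub>3 = - (e\<^sub>1 * e\<^sub>2 * r\<^sub>0)" and r0: "r\<^sub>0 \<in> Q8_normalizer"
    using assms(1) unfolding parallelogram_def by blast
  obtain c\<^sub>1 c\<^sub>2 where c: "c\<^sub>1 \<in> Q" "c\<^sub>2 \<in> Q" "qcnj r\<^sub>0 * qcnj e\<^sub>1 = c\<^sub>1 * qcnj r\<^sub>0"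
      "qcnj r\<^sub>0 * qcnj e\<^sub>2 = c\<^sub>2 * qcnj r\<^sub>0"
    using Q8_normalizerD(2)[OF Q8_normalizer_qcnj[OF r0]] Q8_qcnj e by meson
  have neg: "qcnj (- x) = - qcnj x" for x
    by (cases x) simp
  have "qcnj (e\<^sub>1 * e\<^sub>2 * r\<^sub>0) = qcnj r\<^sub>0 * qcnj e\<^sub>2 * qcnj e\<^sub>1"
    by (simp add: qcnj_mult mult.assoc)
  also have "\<dots> = c\<^sub>2 * c\<^sub>1 * qcnj r\<^sub>0"
    by (simp add: c mult.assoc)
  finally have "qcnj r\<^sub>3 = c\<^sub>2 * c\<^sub>1 * qcnj r\<^sub>0 \<or> qcnj r\<^sub>3 = - (c\<^sub>2 * c\<^sub>1 * qcnj r\<^sub>0)"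
    using e(5) neg by auto
  \<comment> \<open>Conjugation reversed the two factors; restoring their order costs at most a
    sign.\<close>
  moreover have "c\<^sub>2 * c\<^sub>1 = c\<^sub>1 * c\<^sub>2 \<or> c\<^sub>2 * c\<^sub>1 = - (c\<^sub>1 * c\<^sub>2)"
    using c by (intro Q8_commute_up_to_sign)
  ultimately have "qcnj r\<^sub>3 = c\<^sub>1 * c\<^sub>2 * qcnj r\<^sub>0 \<or> qcnj r\<^sub>3 = - (c\<^sub>1 * c\<^sub>2 * qcnj r\<^sub>0)"
    by auto
  moreover have "qcnj r\<^sub>1 = c\<^sub>1 * qcnj r\<^sub>0" "qcnj r\<^sub>2 = c\<^sub>2 * qcnj r\<^sub>0"
    using e c by (simp_all add: qcnj_mult)
  ultimately show ?thesis
    using Q8_normalizer_qcnj[OF r0] c(1,2) unfolding parallelogram_def by blast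
qed

lemma parallelogram_translates:
  assumes "r \<in> Q8_normalizer" "x \<in> Q" "y \<in> Q"
  shows "parallelogram r (x * r) (y * r) (x * y * r)"
  using assms unfolding parallelogram_def by blast

text \<open>The word uses only products and conjugates, both of which preserve parallelograms. This
  is what makes it multiplicative modulo signs later.\<close>

lemma parallelogram_prod_qcomm:
  assumes "\<And>i. i \<in> set is \<Longrightarrow> parallelogram (u\<^sub>0 i) (u\<^sub>1 i) (u\<^sub>2 i) (u\<^sub>3 i)"
    and "\<And>i. i \<in> set is \<Longrightarrow> parallelogram (t\<^sub>0 i) (t\<^sub>1 i) (t\<^sub>2 i) (t\<^sub>3 i)"
  defines "R \<equiv> \<lambda>u t. prod_list (map (\<lambda>i. qcomm (u i) (t i)) is)"
  shows "parallelogram (R u\<^sub>0 t\<^sub>0) (R u\<^sub>1 t\<^sub>1) (R u\<^sub>2 t\<^sub>2) (R u\<^sub>3 t\<^sub>3)"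
  using assms(1,2) unfolding R_def
  by (induction "is") (simp_all add: parallelogram_one parallelogram_mult parallelogram_qcnj qcomm_def)

lemma sym3_prod_qcomm:
  assumes "\<And>i. i \<in> set is \<Longrightarrow> u i \<in> sym3 \<and> t i \<in> sym3"
  shows "prod_list (map (\<lambda>i. qcomm (u i) (t i)) is) \<in> sym3"
  using assms by (induction "is") (simp_all add: sym3_one sym3_mult sym3_qcnj qcomm_def)

section \<open>Commutator products and groups with a normal copy of Q8\<close>

lemma (in group) foldr_mult_closed:
  "(\<And>i. i \<in> set is \<Longrightarrow> c i \<in> carrier G) \<Longrightarrow> foldr (\<otimes>) (map c is) \<one> \<in> carrier G"
  by (induction "is") auto

lemma commutator_closed:
  assumes "group G" "x \<in> carrier G" "y \<in> carrier G"
  shows "commutator G x y \<in> carrier G"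
proof -
  interpret group G by fact
  show ?thesis using assms by (simp add: commutator_def)
qed

lemma (in group_hom) hom_commutator:
  "x \<in> carrier G \<Longrightarrow> y \<in> carrier G \<Longrightarrow> h (commutator G x y) = commutator H (h x) (h y)"
  by (simp add: commutator_def)

lemma (in group_hom) hom_foldr_mult:
  "(\<And>i. i \<in> set is \<Longrightarrow> c i \<in> carrier G) \<Longrightarrow>
    h (foldr (\<otimes>) (map c is) \<one>) = foldr (\<otimes>\<^bsub>H\<^esub>) (map (\<lambda>i. h (c i)) is) \<one>\<^bsub>H\<^esub>"
proof (induction "is")
  case (Cons i "is")
  then have "c i \<in> carrier G" "foldr (\<otimes>) (map c is) \<one> \<in> carrier G"
    by (auto intro: G.foldr_mult_closed)
  then show ?case
    using Cons by simp
qed simp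

lemma (in group_hom) hom_commutator_prod:
  assumes "\<And>i. i \<in> {1..d} \<Longrightarrow> a i \<in> carrier G" "\<And>i. i \<in> {1..d} \<Longrightarrow> b i \<in> carrier G"
  shows "h (commutator_prod G d a b) = commutator_prod H d (\<lambda>i. h (a i)) (\<lambda>i. h (b i))"
proof -
  have "h (commutator_prod G d a b) =
      foldr (\<otimes>\<^bsub>H\<^esub>) (map (\<lambda>i. h (commutator G (a i) (b i))) [1..<Suc d]) \<one>\<^bsub>H\<^esub>"
    unfolding commutator_prod_def
    by (rule hom_foldr_mult) (use assms in \<open>auto intro!: commutator_closed is_group\<close>)
  also have "map (\<lambda>i. h (commutator G (a i) (b i))) [1..<Suc d] =
      map (\<lambda>i. commutator H (h (a i)) (h (b i))) [1..<Suc d]"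
    using assms by (intro map_cong) (auto simp: hom_commutator)
  finally show ?thesis
    unfolding commutator_prod_def .
qed

text \<open>Of the exact sequence only the normal copy of \<open>Q8\<close> is kept. Normality has
  the shape of \<open>r * z = z' * r\<close>, so group elements and quaternions can be compared
  directly.\<close>

locale Q8_normal_embedding = group G for G (structure) +
  fixes f :: "quat \<Rightarrow> 'a"
  assumes f_mon: "f \<in> mon Q8 G"
    and f_normal: "g \<in> carrier G \<Longrightarrow> z \<in> Q \<Longrightarrow> \<exists>z'\<in>Q. g \<otimes> f z = f z' \<otimes> g"
begin

lemma f_closed [simp, intro]: "z \<in> Q \<Longrightarrow> f z \<in> carrier G"
  using f_mon unfolding mon_def by (auto simp: hom_def)

lemma f_mult: "x \<in> Q \<Longrightarrow> y \<in> Q \<Longrightarrow> f (x * y) = f x \<otimes> f y"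
  using f_mon unfolding mon_def by (auto simp: hom_def)

lemma f_inj: "f x = f y \<Longrightarrow> x \<in> Q \<Longrightarrow> y \<in> Q \<Longrightarrow> x = y"
  using f_mon unfolding mon_def by (auto dest: inj_onD)

lemma f_one [simp]: "f 1 = \<one>"
  using f_mult[of 1 1] f_closed[of 1] Q8_one by (metis l_cancel_one mult_1)

lemma f_inv: "x \<in> Q \<Longrightarrow> inv (f x) = f (qcnj x)"
  by (intro inv_equality) (simp_all add: Q8_qcnj Q8_mult_qcnj f_mult[symmetric])

text \<open>The same \<open>z'\<close> serves \<open>g\<close> and \<open>r\<close>: conjugation by
  the quaternion \<open>r\<close> realizes the automorphism of \<open>Q8\<close> induced by
  \<open>g\<close>.\<close>

definition intertwines :: "'a \<Rightarrow> quat \<Rightarrow> bool" where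
  "intertwines g r \<longleftrightarrow> g \<in> carrier G \<and> r \<noteq> 0 \<and>
     (\<forall>z\<in>Q. \<exists>z'\<in>Q. g \<otimes> f z = f z' \<otimes> g \<and> r * z = z' * r) \<and>
     (\<forall>z'\<in>Q. \<exists>z\<in>Q. g \<otimes> f z = f z' \<otimes> g \<and> r * z = z' * r)"

lemma intertwinesD:
  assumes "intertwines g r"
  shows "g \<in> carrier G" "r \<noteq> 0" "r \<in> Q8_normalizer"
    "z \<in> Q \<Longrightarrow> \<exists>z'\<in>Q. g \<otimes> f z = f z' \<otimes> g \<and> r * z = z' * r"
    "z' \<in> Q \<Longrightarrow> \<exists>z\<in>Q. g \<otimes> f z = f z' \<otimes> g \<and> r * z = z' * r"
  using assms unfolding intertwines_def Q8_normalizer_def by auto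

lemma intertwines_one: "intertwines \<one> 1"
  unfolding intertwines_def by auto

lemma f_intertwine_mult:
  assumes "g \<in> carrier G" "h \<in> carrier G" "z \<in> Q" "z' \<in> Q" "z'' \<in> Q"
    and "h \<otimes> f z = f z' \<otimes> h" "g \<otimes> f z' = f z'' \<otimes> g"
  shows "g \<otimes> h \<otimes> f z = f z'' \<otimes> (g \<otimes> h)"
proof -
  have "g \<otimes> h \<otimes> f z = g \<otimes> f z' \<otimes> h"
    using assms(1-6) by (simp add: m_assoc)
  also have "\<dots> = f z'' \<otimes> g \<otimes> h"
    by (simp only: assms)
  finally show ?thesis
    using assms(1-5) by (simp add: m_assoc)
qed

lemma f_intertwine_inv:
  assumes "g \<in> carrier G" "z \<in> Q" "z' \<in> Q" "g \<otimes> f z = f z' \<otimes> g"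
  shows "inv g \<otimes> f z' = f z \<otimes> inv g"
proof -
  have "inv g \<otimes> f z' = inv g \<otimes> (f z' \<otimes> g) \<otimes> inv g"
    using assms(1-3) by (simp add: m_assoc)
  also have "\<dots> = inv g \<otimes> (g \<otimes> f z) \<otimes> inv g"
    by (simp only: assms)
  also have "\<dots> = f z \<otimes> inv g"
    using assms(1-3) by (simp add: m_assoc[symmetric])
  finally show ?thesis .
qed

lemma intertwines_mult:
  assumes "intertwines g r" "intertwines h s"
  shows "intertwines (g \<otimes> h) (r * s)"
proof -
  note g = intertwinesD[OF assms(1)] and h = intertwinesD[OF assms(2)]
  have comp: "g \<otimes> h \<otimes> f z = f z'' \<otimes> (g \<otimes> h) \<and> r * s * z = z'' * (r * s)"
    if "z \<in> Q" "z' \<in> Q" "z'' \<in> Q" "h \<otimes> f z = f z' \<otimes> h \<and> s * z = z' * s"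
      "g \<otimes> f z' = f z'' \<otimes> g \<and> r * z' = z'' * r" for z z' z''
  proof
    show "g \<otimes> h \<otimes> f z = f z'' \<otimes> (g \<otimes> h)"
      using f_intertwine_mult[OF g(1) h(1) that(1-3)] that(4,5) by blast
    show "r * s * z = z'' * (r * s)"
      using that(4,5) by (metis mult.assoc)
  qed
  have "\<exists>z''\<in>Q. g \<otimes> h \<otimes> f z = f z'' \<otimes> (g \<otimes> h) \<and> r * s * z = z'' * (r * s)" if z: "z \<in> Q" for z
  proof -
    obtain z' where z': "z' \<in> Q" "h \<otimes> f z = f z' \<otimes> h \<and> s * z = z' * s"
      using h(4)[OF z] by blast
    obtain z'' where "z'' \<in> Q" "g \<otimes> f z' = f z'' \<otimes> g \<and> r * z' = z'' * r"
      using g(4)[OF z'(1)] by blast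
    then show ?thesis
      using comp[OF z z'(1) _ z'(2)] by blast
  qed
  moreover have "\<exists>z\<in>Q. g \<otimes> h \<otimes> f z = f z'' \<otimes> (g \<otimes> h) \<and> r * s * z = z'' * (r * s)"
    if z'': "z'' \<in> Q" for z''
  proof -
    obtain z' where z': "z' \<in> Q" "g \<otimes> f z' = f z'' \<otimes> g \<and> r * z' = z'' * r"
      using g(5)[OF z''] by blast
    obtain z where "z \<in> Q" "h \<otimes> f z = f z' \<otimes> h \<and> s * z = z' * s"
      using h(5)[OF z'(1)] by blast
    then show ?thesis
      using comp[OF _ z'(1) z'' _ z'(2)] by blast
  qed
  ultimately show ?thesis
    using g h unfolding intertwines_def by simp
qed

lemma intertwines_inv:
  assumes "intertwines g r"
  shows "intertwines (inv g) (qcnj r)"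
proof -
  note g = intertwinesD[OF assms(1)]
  have conv: "inv g \<otimes> f z' = f z \<otimes> inv g \<and> qcnj r * z' = z * qcnj r"
    if "z \<in> Q" "z' \<in> Q" "g \<otimes> f z = f z' \<otimes> g \<and> r * z = z' * r" for z z'
    using that f_intertwine_inv[OF g(1) that(1,2)] qcnj_intertwines[OF g(2)] by blast
  have "\<exists>z'\<in>Q. inv g \<otimes> f z = f z' \<otimes> inv g \<and> qcnj r * z = z' * qcnj r" if "z \<in> Q" for z
    using g(5)[OF that] conv that by blast
  moreover have "\<exists>z\<in>Q. inv g \<otimes> f z = f z' \<otimes> inv g \<and> qcnj r * z = z' * qcnj r" if "z' \<in> Q" for z'
    using g(4)[OF that] conv that by blast
  ultimately show ?thesis
    using g unfolding intertwines_def by simp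
qed

text \<open>A single \<open>e\<close> shifts both the group element and its quaternion. Products and
  inverses preserve this, so a word in the group and the same word in the quaternions change by a
  common factor from \<open>Q8\<close>.\<close>

definition translates :: "'a \<Rightarrow> quat \<Rightarrow> 'a \<Rightarrow> quat \<Rightarrow> bool" where
  "translates g r g' r' \<longleftrightarrow> intertwines g r \<and> (\<exists>e\<in>Q. g' = f e \<otimes> g \<and> r' = e * r)"

lemma translates_one: "translates \<one> 1 \<one> 1"
  unfolding translates_def using intertwines_one Q8_one by force

lemma translates_mult:
  assumes "translates g r g' r'" "translates h s h' s'"
  shows "translates (g \<otimes> h) (r * s) (g' \<otimes> h') (r' * s')"
proof -
  obtain e where e: "e \<in> Q" "g' = f e \<otimes> g" "r' = e * r" and gr: "intertwines g r"
    using assms(1) unfolding translates_def by blast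
  obtain d where d: "d \<in> Q" "h' = f d \<otimes> h" "s' = d * s" and hs: "intertwines h s"
    using assms(2) unfolding translates_def by blast
  obtain c where c: "c \<in> Q" "g \<otimes> f d = f c \<otimes> g" "r * d = c * r"
    using intertwinesD(4)[OF gr] d by blast
  note [simp] = intertwinesD(1)[OF gr] intertwinesD(1)[OF hs]
  have "g' \<otimes> h' = f e \<otimes> (g \<otimes> f d) \<otimes> h"
    using e d by (simp add: m_assoc)
  also have "\<dots> = f (e * c) \<otimes> (g \<otimes> h)"
    using e c by (simp add: m_assoc f_mult)
  finally have "g' \<otimes> h' = f (e * c) \<otimes> (g \<otimes> h)" .
  moreover have "r' * s' = e * (r * d) * s"
    by (simp add: e d mult.assoc)
  then have "r' * s' = e * c * (r * s)"
    by (simp add: c mult.assoc)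
  ultimately show ?thesis
    using intertwines_mult[OF gr hs] e(1) c(1) unfolding translates_def by blast
qed

lemma translates_inv:
  assumes "translates g r g' r'"
  shows "translates (inv g) (qcnj r) (inv g') (qcnj r')"
proof -
  obtain e where e: "e \<in> Q" "g' = f e \<otimes> g" "r' = e * r" and gr: "intertwines g r"
    using assms(1) unfolding translates_def by blast
  obtain c where c: "c \<in> Q" "inv g \<otimes> f (qcnj e) = f c \<otimes> inv g" "qcnj r * qcnj e = c * qcnj r"
    using intertwinesD(4)[OF intertwines_inv[OF gr]] e by blast
  have "inv g' = f c \<otimes> inv g"
    using e c intertwinesD(1)[OF gr] by (simp add: inv_mult_group f_inv)
  moreover have "qcnj r' = c * qcnj r"
    using e c by (simp add: qcnj_mult)
  ultimately show ?thesis
    using intertwines_inv[OF gr] c(1) unfolding translates_def by blast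
qed

lemma translates_commutator_prod:
  assumes "\<And>i. i \<in> {1..d} \<Longrightarrow> translates (a\<^sub>0 i) (u\<^sub>0 i) (a i) (u i)"
    and "\<And>i. i \<in> {1..d} \<Longrightarrow> translates (b\<^sub>0 i) (t\<^sub>0 i) (b i) (t i)"
  defines "R \<equiv> \<lambda>u t. prod_list (map (\<lambda>i. qcomm (u i) (t i)) [1..<Suc d])"
  shows "translates (commutator_prod G d a\<^sub>0 b\<^sub>0) (R u\<^sub>0 t\<^sub>0) (commutator_prod G d a b) (R u t)"
proof -
  \<comment> \<open>Arbitrary index lists are allowed because the induction removes the first
    index.\<close>
  have "translates (foldr (\<otimes>) (map (\<lambda>i. commutator G (a\<^sub>0 i) (b\<^sub>0 i)) is) \<one>)
      (prod_list (map (\<lambda>i. qcomm (u\<^sub>0 i) (t\<^sub>0 i)) is))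
      (foldr (\<otimes>) (map (\<lambda>i. commutator G (a i) (b i)) is) \<one>)
      (prod_list (map (\<lambda>i. qcomm (u i) (t i)) is))" if "set is \<subseteq> {1..d}" for "is"
    using that
  proof (induction "is")
    case Nil
    show ?case
      by (simp add: translates_one)
  next
    case (Cons i "is")
    then have "translates (commutator G (a\<^sub>0 i) (b\<^sub>0 i)) (qcomm (u\<^sub>0 i) (t\<^sub>0 i))
        (commutator G (a i) (b i)) (qcomm (u i) (t i))"
      unfolding commutator_def qcomm_def using assms(1,2)[of i]
      by (simp add: translates_mult translates_inv)
    then show ?case
      using Cons by (simp add: translates_mult)
  qed
  moreover have "set [1..<Suc d] \<subseteq> {1..d}"
    by auto
  ultimately show ?thesis
    unfolding commutator_prod_def R_def by blast
qed

text \<open>Conjugation by \<open>g\<close> sends i and j to some \<open>p\<close> and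
  \<open>s\<close>, to which the enumeration of automorphisms applies. It yields \<open>e\<close>
  and \<open>u\<close> with the right relations for i and j, and these two generate
  \<open>Q8\<close>.\<close>

lemma ex_sym3_intertwiner:
  assumes "g \<in> carrier G"
  shows "\<exists>e\<in>Q. \<exists>u\<in>sym3. intertwines (f e \<otimes> g) u"
proof -
  let ?i = "Quat 0 1 0 0" and ?j = "Quat 0 0 1 0"
  have ij: "?i \<in> Q" "?j \<in> Q"
    by (auto simp: Q8_def)
  have conj_mult: "h \<otimes> f (x * y) = f (x' * y') \<otimes> h"
    if "h \<in> carrier G" "x \<in> Q" "y \<in> Q" "x' \<in> Q" "y' \<in> Q" "h \<otimes> f x = f x' \<otimes> h" "h \<otimes> f y = f y' \<otimes> h"
    for h x y x' y'
  proof -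
    have "h \<otimes> f (x * y) = h \<otimes> f x \<otimes> f y"
      using that(1-5) by (simp add: f_mult m_assoc)
    also have "\<dots> = f x' \<otimes> (h \<otimes> f y)"
      unfolding that(6) using that(1-5) by (simp add: m_assoc)
    also have "\<dots> = f (x' * y') \<otimes> h"
      unfolding that(7) using that(1-5) by (simp add: f_mult m_assoc)
    finally show ?thesis .
  qed
  \<comment> \<open>Conjugation is injective; applied to the squares of i, j and i j this shows that
    \<open>p\<close>, \<open>s\<close> and \<open>p * s\<close> have order 4.\<close>
  have ne_1: "x' \<noteq> 1" if "x \<in> Q" "x \<noteq> 1" "g \<otimes> f x = f x' \<otimes> g" for x x'
    using that f_inj[of x 1] assms Q8_one by auto
  obtain p where p: "p \<in> Q" "g \<otimes> f ?i = f p \<otimes> g"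
    using f_normal[OF assms ij(1)] by blast
  obtain s where s: "s \<in> Q" "g \<otimes> f ?j = f s \<otimes> g"
    using f_normal[OF assms ij(2)] by blast
  have ps: "g \<otimes> f (?i * ?j) = f (p * s) \<otimes> g"
    using conj_mult assms ij p s by blast
  have sq: "?i * ?i \<in> Q" "?i * ?i \<noteq> 1" "?j * ?j \<in> Q" "?j * ?j \<noteq> 1"
    "?i * ?j * (?i * ?j) \<in> Q" "?i * ?j * (?i * ?j) \<noteq> 1"
    by (simp_all add: Q8_def one_quat_def)
  have "p * p \<noteq> 1"
    by (rule ne_1[OF sq(1,2)]) (rule conj_mult[OF assms ij(1) ij(1) p(1) p(1) p(2) p(2)])
  moreover have "s * s \<noteq> 1"
    by (rule ne_1[OF sq(3,4)]) (rule conj_mult[OF assms ij(2) ij(2) s(1) s(1) s(2) s(2)])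
  moreover have "p * s * (p * s) \<noteq> 1"
    using Q8_mult[OF p(1) s(1)] Q8_mult[OF ij]
    by (intro ne_1[OF sq(5,6)] conj_mult[OF assms _ _ _ _ ps ps])
  ultimately obtain e u where e: "e \<in> Q" and u: "u \<in> sym3" "u \<noteq> 0"
    and ep: "e * p * qcnj e * u = u * ?i" and es: "e * s * qcnj e * u = u * ?j"
    using Q8_automorphism_intertwiner p(1) s(1) by blast
  define h where "h = f e \<otimes> g"
  have h: "h \<in> carrier G"
    using e assms by (simp add: h_def)
  have conj_e: "h \<otimes> f z = f (e * z' * qcnj e) \<otimes> h"
    if "z \<in> Q" "z' \<in> Q" "g \<otimes> f z = f z' \<otimes> g" for z z'
  proof -
    have "f (e * z' * qcnj e) \<otimes> h = f (e * z') \<otimes> inv (f e) \<otimes> (f e \<otimes> g)"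
      using e that(2) by (simp add: h_def f_inv f_mult[symmetric] Q8_mult Q8_qcnj)
    also have "\<dots> = f (e * z') \<otimes> g"
      using e that(2) assms Q8_mult[OF e that(2)]
      by (simp add: m_assoc[of "f (e * z')"] m_assoc[symmetric, of "inv (f e)"])
    also have "\<dots> = f e \<otimes> (f z' \<otimes> g)"
      using e that(2) assms by (simp add: f_mult m_assoc)
    also have "\<dots> = h \<otimes> f z"
      unfolding that(3)[symmetric] h_def using e that(1) assms by (simp add: m_assoc)
    finally show ?thesis ..
  qed
  define P where "P z \<longleftrightarrow> z \<in> Q \<and> (\<exists>z'\<in>Q. h \<otimes> f z = f z' \<otimes> h \<and> u * z = z' * u)" for z
  have P: "P z" if "z \<in> Q" for z
  proof (rule Q8_generated[of P, OF _ _ _ that])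
    show "P ?i" "P ?j"
      using conj_e p s ij ep es e unfolding P_def by (metis Q8_mult Q8_qcnj)+
  next
    fix x y assume "P x" "P y"
    then obtain x' y' where *: "x \<in> Q" "y \<in> Q" "x' \<in> Q" "y' \<in> Q" "h \<otimes> f x = f x' \<otimes> h"
        "h \<otimes> f y = f y' \<otimes> h" "u * x = x' * u" "u * y = y' * u"
      unfolding P_def by blast
    have "u * (x * y) = x' * y' * u"
      using * by (metis mult.assoc)
    then show "P (x * y)"
      using * conj_mult[OF h *(1-6)] unfolding P_def by blast
  qed
  \<comment> \<open>A preimage for \<open>h\<close> comes from normality applied to
    \<open>inv h\<close>. The image of it that \<open>P\<close> supplies must be \<open>z'\<close>
    again because \<open>f\<close> is injective.\<close>
  have "\<exists>z\<in>Q. h \<otimes> f z = f z' \<otimes> h \<and> u * z = z' * u" if z': "z' \<in> Q" for z'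
  proof -
    obtain z where z: "z \<in> Q" "inv h \<otimes> f z' = f z \<otimes> inv h"
      using f_normal[OF inv_closed[OF h] z'] by blast
    then have eq: "h \<otimes> f z = f z' \<otimes> h"
      using f_intertwine_inv[OF inv_closed[OF h] z' z(1) z(2)] h by simp
    obtain z'' where z'': "z'' \<in> Q" "h \<otimes> f z = f z'' \<otimes> h" "u * z = z'' * u"
      using P[OF z(1)] unfolding P_def by blast
    then have "f z'' = f z'"
      using eq h z' by simp
    then show ?thesis
      using z'' z(1) z' eq f_inj by blast
  qed
  then have "intertwines h u"
    using P h u(2) unfolding intertwines_def P_def by blast
  then show ?thesis
    using e u(1) unfolding h_def by blast
qed

end


section \<open>Counting\<close>

text \<open>Distributivity for an ordered product, as needed in a noncommutative ring: splitting off
  the value at the head index keeps its factor on the left.\<close>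

lemma sum_prod_list_PiE:
  fixes F :: "'i \<Rightarrow> 'a \<Rightarrow> 'r :: semiring_1"
  assumes "distinct is"
  shows "(\<Sum>z\<in>Pi\<^sub>E (set is) (\<lambda>_. A). prod_list (map (\<lambda>i. F i (z i)) is)) =
         prod_list (map (\<lambda>i. \<Sum>p\<in>A. F i p) is)"
  using assms
proof (induction "is")
  case (Cons i "is")
  let ?P = "Pi\<^sub>E (set is) (\<lambda>_. A)"
  have i: "i \<notin> set is"
    using Cons.prems by simp
  have eq: "prod_list (map (\<lambda>j. F j ((g(i := y)) j)) (i # is)) =
      F i y * prod_list (map (\<lambda>j. F j (g j)) is)" for g y
  proof -
    have "map (\<lambda>j. F j ((g(i := y)) j)) is = map (\<lambda>j. F j (g j)) is"
      using i by (intro map_cong) auto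
    then show ?thesis
      by (simp only: list.map prod_list.Cons fun_upd_same)
  qed
  have "(\<Sum>z\<in>Pi\<^sub>E (set (i # is)) (\<lambda>_. A). prod_list (map (\<lambda>j. F j (z j)) (i # is))) =
      (\<Sum>(y, g)\<in>A \<times> ?P. prod_list (map (\<lambda>j. F j ((g(i := y)) j)) (i # is)))"
    using inj_combinator[OF i, of "\<lambda>_. A"]
    by (simp only: list.set PiE_insert_eq sum.reindex comp_def case_prod_unfold)
  also have "\<dots> = (\<Sum>(y, g)\<in>A \<times> ?P. F i y * prod_list (map (\<lambda>j. F j (g j)) is))"
    by (simp only: eq)
  also have "\<dots> = (\<Sum>y\<in>A. F i y) * (\<Sum>g\<in>?P. prod_list (map (\<lambda>j. F j (g j)) is))"
    by (simp add: sum_product sum.cartesian_product)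
  finally show ?case
    using Cons by simp
qed simp

text \<open>The first isomorphism theorem with Lagrange's theorem; the codomain is shrunk to the
  image to make \<open>h\<close> onto.\<close>

lemma (in group_hom) card_kernel_mult_card_image:
  "card (kernel G H h) * card (h ` carrier G) = order G"
proof -
  interpret I: group_hom G "H\<lparr>carrier := h ` carrier G\<rparr>" h
    using H.subgroup_imp_group[OF img_is_subgroup] G.is_group homh
    by (intro group_hom.intro group_hom_axioms.intro) (auto simp: hom_def)
  have "kernel G (H\<lparr>carrier := h ` carrier G\<rparr>) h = kernel G H h"
    by (simp add: kernel_def)
  then have "card (rcosets kernel G H h) = card (h ` carrier G)"
    using I.FactGroup_iso_set by (auto simp: iso_def FactGroup_def dest: bij_betw_same_card)
  then show ?thesis
    using G.lagrange[OF subgroup_kernel] by (simp add: mult.commute)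
qed

abbreviation Q8_center :: "quat set" where
  "Q8_center \<equiv> {1, - 1}"

lemma normal_Q8_center: "Q8_center \<lhd> Q8"
proof -
  interpret group Q8 by (rule group_Q8)
  have "inv\<^bsub>Q8\<^esub> (- 1) = - 1"
    by (rule inv_equality) (auto simp: carrier_Q8)
  moreover have "inv\<^bsub>Q8\<^esub> 1 = 1"
    using inv_one by simp
  ultimately have "subgroup Q8_center Q8"
    by unfold_locales (auto simp: carrier_Q8)
  then show ?thesis
    by (rule normalI) (auto simp: r_coset_def l_coset_def)
qed

lemma order_Q8_Mod_center: "order (Q8 Mod Q8_center) = 4"
proof -
  interpret normal Q8_center Q8 by (rule normal_Q8_center)
  have "(1::quat) \<noteq> - 1"
    by (simp add: one_quat_def)
  then show ?thesis
    using lagrange[OF is_subgroup] order_Q8 by (simp add: order_def FactGroup_def)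
qed

section \<open>The word map on pairs of elements of Q8 and its value counts\<close>

definition qcomm_word :: "nat \<Rightarrow> (nat \<Rightarrow> quat) \<Rightarrow> (nat \<Rightarrow> quat) \<Rightarrow> (nat \<Rightarrow> quat \<times> quat) \<Rightarrow> quat" where
  "qcomm_word d u t z = prod_list (map (\<lambda>i. qcomm (fst (z i) * u i) (snd (z i) * t i)) [1..<Suc d])"

abbreviation Q8_pairs :: "nat \<Rightarrow> (nat \<Rightarrow> quat \<times> quat) set" where
  "Q8_pairs d \<equiv> {1..d} \<rightarrow>\<^sub>E Q \<times> Q"

text \<open>The count needs nothing of the extension beyond the function \<open>w\<close>. The
  central value at the base point makes \<open>w\<close> multiplicative modulo signs, not merely up
  to a translation.\<close>

locale scaled_qcomm_word =
  fixes d :: nat and u t :: "nat \<Rightarrow> quat" and m :: int and w :: "(nat \<Rightarrow> quat \<times> quat) \<Rightarrow> quat"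
  assumes normalizer: "i \<in> {1..d} \<Longrightarrow> u i \<in> Q8_normalizer" "i \<in> {1..d} \<Longrightarrow> t i \<in> Q8_normalizer"
    and m_nonzero: "m \<noteq> 0"
    and w_closed: "z \<in> Q8_pairs d \<Longrightarrow> w z \<in> Q"
    and R_eq: "z \<in> Q8_pairs d \<Longrightarrow> qcomm_word d u t z = of_int m * w z"
    and w_one: "w (\<lambda>i\<in>{1..d}. (1, 1)) \<in> Q8_center"
begin

abbreviation "P \<equiv> Q8_pairs d"

abbreviation "R \<equiv> qcomm_word d u t"

lemma one_in_P: "(\<lambda>i\<in>{1..d}. (1, 1)) \<in> P"
  by auto

lemma finite_P: "finite P"
  by (intro finite_PiE) (auto simp: Q8_def)

lemma card_P: "card P = 64 ^ d"
  using order_Q8 by (simp add: card_PiE card_cartesian_product order_def)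

text \<open>Norms are compared at the base point: the unit \<open>w z\<close> has norm 1 and each
  \<open>qcomm\<close> has a square norm, so \<open>m\<close> and the product have equal
  squares.\<close>

lemma abs_m: "\<bar>m\<bar> = prod_list (map (\<lambda>i. qnorm (u i) * qnorm (t i)) [1..<Suc d])" (is "_ = ?M")
proof -
  have qnorm_list: "qnorm (prod_list (map (\<lambda>i. qcomm (u' i) (t' i)) is)) =
      (prod_list (map (\<lambda>i. qnorm (u' i) * qnorm (t' i)) is))\<^sup>2" for u' t' and "is" :: "nat list"
    by (induction "is") (simp_all add: one_quat_def qnorm_mult qnorm_qcomm power_mult_distrib)
  have "R (\<lambda>i\<in>{1..d}. (1, 1)) = prod_list (map (\<lambda>i. qcomm (u i) (t i)) [1..<Suc d])"
    unfolding qcomm_word_def by (intro arg_cong[where f = prod_list] map_cong) auto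
  then have "qnorm (R (\<lambda>i\<in>{1..d}. (1, 1))) = ?M\<^sup>2"
    by (simp only: qnorm_list)
  then have sq: "m\<^sup>2 = ?M\<^sup>2"
    unfolding R_eq[OF one_in_P] qnorm_mult qnorm_Q8[OF w_closed[OF one_in_P]]
    by (simp only: of_int_quat qnorm.simps) simp
  have "?M \<ge> 0"
    by (rule prod_list_nonneg) (auto simp: qnorm_nonneg)
  then show ?thesis
    using sq by (simp only: power2_eq_iff) linarith
qed

lemma signed_count:
  "\<bar>int (card {z \<in> P. w z = 1}) - int (card {z \<in> P. w z = - 1})\<bar> = 16 ^ d" (is "\<bar>?D\<bar> = _")
proof -
  define M where "M = (\<lambda>i. qnorm (u i) * qnorm (t i))"
  have scale: "prod_list (map (\<lambda>i. of_int (c * M i)) is) =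
      (of_int (c ^ length is * prod_list (map M is)) :: quat)" for c and "is" :: "nat list"
    by (induction "is") (simp_all flip: of_int_mult add: mult_ac)
  \<comment> \<open>The pairs at different indices vary independently, so the sum factors and
    \<open>sum_qcomm\<close> evaluates each factor.\<close>
  have "(\<Sum>z\<in>P. R z) =
      prod_list (map (\<lambda>i. \<Sum>p\<in>Q \<times> Q. qcomm (fst p * u i) (snd p * t i)) [1..<Suc d])"
    using sum_prod_list_PiE[of "[1..<Suc d]" "\<lambda>i p. qcomm (fst p * u i) (snd p * t i)" "Q \<times> Q"]
    unfolding qcomm_word_def by (simp only: distinct_upt set_upt atLeastLessThanSuc_atLeastAtMost)
  also have "\<dots> = prod_list (map (\<lambda>i. of_int (16 * M i)) [1..<Suc d])"
    using sum_qcomm by (simp only: case_prod_unfold M_def)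
  also have "\<dots> = of_int (16 ^ d * \<bar>m\<bar>)"
    unfolding scale abs_m by (simp only: M_def length_upt diff_Suc_1)
  finally have "qre (\<Sum>z\<in>P. R z) = 16 ^ d * \<bar>m\<bar>"
    by (simp only: of_int_quat qre.simps)
  moreover have "qre (\<Sum>z\<in>P. R z) = (\<Sum>z\<in>P. m * (of_bool (w z = 1) - of_bool (w z = - 1)))"
    unfolding qre_sum
    by (intro sum.cong) (simp_all only: R_eq qre_of_int_mult qre_Q8 w_closed)
  moreover have "\<dots> = m * ?D"
  proof -
    have "(\<Sum>z\<in>P. of_bool (w z = c)) = int (card {z \<in> P. w z = c})" for c
      using finite_P by (simp add: of_bool_def sum.If_cases Int_def)
    then show ?thesis
      by (simp only: sum_distrib_left[symmetric] sum_subtractf)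
  qed
  ultimately have "m * ?D = 16 ^ d * \<bar>m\<bar>"
    by linarith
  \<comment> \<open>Absolute values remove the unknown sign of \<open>m\<close>.\<close>
  then have "\<bar>m\<bar> * \<bar>?D\<bar> = \<bar>m\<bar> * 16 ^ d"
    by (simp only: abs_mult[symmetric]) (simp only: abs_mult abs_abs power_abs abs_numeral mult.commute)
  then show ?thesis
    using m_nonzero by (simp only: mult_cancel_left abs_eq_0_iff) blast
qed

text \<open>At each index the base point, \<open>x\<close>, \<open>y\<close> and \<open>xy\<close>
  give a parallelogram, hence so do the four values of the word. Cancelling \<open>m\<close> leaves
  \<open>w x = a * w e\<close>, \<open>w y = b * w e\<close> and \<open>w xy\<close> equal to
  \<open>a * b * w e\<close> up to sign, where \<open>w e\<close> is itself a sign.\<close>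

lemma w_mult_mod_center:
  assumes "x \<in> P" "y \<in> P"
  defines "xy \<equiv> \<lambda>i\<in>{1..d}. (fst (x i) * fst (y i), snd (x i) * snd (y i))"
  shows "w xy = w x * w y \<or> w xy = - (w x * w y)" "xy \<in> P"
proof -
  define e where "e = (\<lambda>i\<in>{1..d}. (1::quat, 1::quat))"
  have mem: "fst (x i) \<in> Q" "snd (x i) \<in> Q" "fst (y i) \<in> Q" "snd (y i) \<in> Q" if "i \<in> {1..d}" for i
    using assms that by (auto dest!: PiE_mem[of _ _ _ i])
  then show xyP: "xy \<in> P"
    unfolding xy_def by auto
  have eP: "e \<in> P"
    unfolding e_def by (rule one_in_P)
  have "parallelogram (R e) (R x) (R y) (R xy)"
    unfolding qcomm_word_def
  proof (rule parallelogram_prod_qcomm)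
    fix i assume "i \<in> set [1..<Suc d]"
    then have i: "i \<in> {1..d}"
      by auto
    show "parallelogram (fst (e i) * u i) (fst (x i) * u i) (fst (y i) * u i) (fst (xy i) * u i)"
      "parallelogram (snd (e i) * t i) (snd (x i) * t i) (snd (y i) * t i) (snd (xy i) * t i)"
      using i mem normalizer by (auto simp: e_def xy_def intro!: parallelogram_translates)
  qed
  then obtain a b where ab: "a \<in> Q" "b \<in> Q" "R x = a * R e" "R y = b * R e"
      "R xy = a * b * R e \<or> R xy = - (a * b * R e)"
    unfolding parallelogram_def by blast
  have cancel: "p = q" if "of_int m * p = of_int m * q" for p q :: quat
    using that m_nonzero by (simp add: of_int_quat_eq_0_iff)
  have scale: "a * (of_int m * b) = of_int m * (a * b)" for a b :: quat
    by (metis mult.assoc mult_of_int_commute)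
  have "w x = a * w e" "w y = b * w e"
    using ab(3,4) unfolding R_eq[OF assms(1)] R_eq[OF assms(2)] R_eq[OF eP] scale
    by (blast intro: cancel)+
  moreover have "w xy = a * b * w e \<or> w xy = - (a * b * w e)"
    using ab(5) cancel unfolding R_eq[OF xyP] R_eq[OF eP] scale mult_minus_right[symmetric]
    by blast
  moreover have "w e \<in> Q8_center"
    unfolding e_def by (rule w_one)
  ultimately show "w xy = w x * w y \<or> w xy = - (w x * w y)"
    by auto
qed

text \<open>Taking \<open>w\<close> modulo signs gives a homomorphism into a group of order 4. The
  set counted is its kernel, and \<open>k\<close> is the order of its image.\<close>

lemma central_count: "\<exists>k\<in>{1, 2, 4}. card {z \<in> P. w z \<in> Q8_center} * k = 64 ^ d"
proof -
  interpret N: normal Q8_center Q8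
    by (rule normal_Q8_center)
  define h where "h z = Q8_center #>\<^bsub>Q8\<^esub> w z" for z
  define PG where "PG = product_group {1..d} (\<lambda>_. Q8 \<times>\<times> Q8)"
  have carrier_PG: "carrier PG = P"
    by (simp add: PG_def)
  have h_eq: "h z = {w z, - w z}" for z
    by (auto simp: h_def r_coset_def)
  interpret group_hom PG "Q8 Mod Q8_center" h
  proof (intro group_hom.intro group_hom_axioms.intro)
    show "group PG"
      unfolding PG_def by (intro product_group DirProd_group group_Q8)
    show "group (Q8 Mod Q8_center)"
      by (rule N.factorgroup_is_group)
    show "h \<in> hom PG (Q8 Mod Q8_center)"
    proof (rule homI)
      fix x assume "x \<in> carrier PG"
      then show "h x \<in> carrier (Q8 Mod Q8_center)"
        using w_closed by (auto simp: carrier_PG FactGroup_def RCOSETS_def h_def)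
    next
      fix x y assume xy: "x \<in> carrier PG" "y \<in> carrier PG"
      have "x \<otimes>\<^bsub>PG\<^esub> y = (\<lambda>i\<in>{1..d}. (fst (x i) * fst (y i), snd (x i) * snd (y i)))"
        by (auto simp: PG_def DirProd_def case_prod_unfold)
      then have "w (x \<otimes>\<^bsub>PG\<^esub> y) = w x * w y \<or> w (x \<otimes>\<^bsub>PG\<^esub> y) = - (w x * w y)"
        using w_mult_mod_center(1) xy unfolding carrier_PG by simp
      then have "h (x \<otimes>\<^bsub>PG\<^esub> y) = Q8_center #>\<^bsub>Q8\<^esub> (w x * w y)"
        by (auto simp: h_eq r_coset_def)
      also have "\<dots> = h x \<otimes>\<^bsub>Q8 Mod Q8_center\<^esub> h y"
        using xy w_closed N.rcos_sum by (simp add: carrier_PG h_def FactGroup_def)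
      finally show "h (x \<otimes>\<^bsub>PG\<^esub> y) = h x \<otimes>\<^bsub>Q8 Mod Q8_center\<^esub> h y" .
    qed
  qed
  have "kernel PG (Q8 Mod Q8_center) h = {z \<in> P. w z \<in> Q8_center}"
    by (auto simp: kernel_def carrier_PG FactGroup_def h_eq doubleton_eq_iff)
  moreover have "card (h ` carrier PG) dvd 4"
    using H.lagrange[OF img_is_subgroup] order_Q8_Mod_center by (metis dvd_triv_right)
  then have "card (h ` carrier PG) \<in> {1, 2, 4}"
  proof -
    assume dvd: "card (h ` carrier PG) dvd 4"
    then have "card (h ` carrier PG) \<le> 4"
      by (rule dvd_imp_le) simp
    then have "card (h ` carrier PG) \<in> {0, 1, 2, 3, 4}"
      by auto
    then show ?thesis
      using dvd by auto
  qed
  ultimately show ?thesis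
    using card_kernel_mult_card_image card_P by (auto simp: order_def carrier_PG)
qed

text \<open>The sum and the difference of the counts of 1 and -1 are known, so adding them gives
  twice the count wanted; the factor 2 keeps everything integral. Here \<open>N\<close> is
  \<open>4 div k\<close>.\<close>

lemma count:
  "\<exists>N\<in>{1, 2, 4 :: nat}. \<exists>\<epsilon>\<in>{1, -1 :: int}.
     2 * int (card {z \<in> P. w z = 1}) = 2 * 8 ^ (2 * d - 1) * int N + \<epsilon> * 16 ^ d" if "d \<ge> 1"
proof -
  let ?N1 = "card {z \<in> P. w z = 1}" and ?N2 = "card {z \<in> P. w z = - 1}"
  obtain k where k: "k \<in> {1, 2, 4}" "card {z \<in> P. w z \<in> Q8_center} * k = 64 ^ d"
    using central_count by blast
  have "{z \<in> P. w z \<in> Q8_center} = {z \<in> P. w z = 1} \<union> {z \<in> P. w z = - 1}"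
    by auto
  moreover have "card \<dots> = ?N1 + ?N2"
    using finite_P by (intro card_Un_disjoint) (auto simp: one_quat_def)
  ultimately have sum: "(?N1 + ?N2) * k = 64 ^ d"
    using k by simp
  obtain \<epsilon> where \<epsilon>: "\<epsilon> \<in> {1, -1 :: int}" "int ?N1 - int ?N2 = \<epsilon> * 16 ^ d"
  proof (cases "int ?N1 - int ?N2 \<ge> 0")
    case True
    then show ?thesis
      using that[of 1] signed_count by simp
  next
    case False
    then show ?thesis
      using that[of "-1"] signed_count by simp
  qed
  \<comment> \<open>The exponent uses truncated subtraction, so \<open>d\<close> must be
    positive.\<close>
  have "(64::nat) ^ d = 8 * 8 ^ (2 * d - 1)" if "d \<ge> 1" for d
  proof -
    have "(64::nat) ^ d = 8 ^ (2 * d)"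
      by (simp add: power_mult)
    also have "\<dots> = 8 * 8 ^ (2 * d - 1)"
      using that by (simp flip: power_Suc)
    finally show ?thesis .
  qed
  then have "?N1 + ?N2 = 2 * 8 ^ (2 * d - 1) * (4 div k)"
    using sum k(1) that by auto
  then have "int (?N1 + ?N2) = int (2 * 8 ^ (2 * d - 1) * (4 div k))"
    by (simp only:)
  then have "2 * int ?N1 = 2 * 8 ^ (2 * d - 1) * int (4 div k) + \<epsilon> * 16 ^ d"
    using \<epsilon>(2) unfolding of_nat_add of_nat_mult of_nat_power of_nat_numeral by linarith
  moreover have "4 div k \<in> {1, 2, 4}"
    using k(1) by auto
  ultimately show ?thesis
    using \<epsilon>(1) by blast
qed

end


section \<open>From lifts to pairs of quaternions, and the final count\<close>

lemma commutator_prod_cong: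
  assumes "\<And>i. i \<in> {1..d} \<Longrightarrow> a i = a' i" "\<And>i. i \<in> {1..d} \<Longrightarrow> b i = b' i"
  shows "commutator_prod G d a b = commutator_prod G d a' b'"
proof -
  have "map (\<lambda>i. commutator G (a i) (b i)) [1..<Suc d] = map (\<lambda>i. commutator G (a' i) (b' i)) [1..<Suc d]"
    using assms by (intro map_cong) auto
  then show ?thesis
    unfolding commutator_prod_def by (simp only:)
qed

text \<open>The fibres of \<open>h\<close> over its image are cosets of the kernel, which is the
  injective image of \<open>Q8\<close>. Every lift is therefore the base lift times
  \<open>f x\<close> for a unique \<open>x\<close>.\<close>

lemma (in group_hom) commutator_lifts_bij:
  fixes f :: "quat \<Rightarrow> 'a"
  assumes f: "f \<in> mon Q8 G" "f ` Q = kernel G H h"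
    and lift: "\<And>i. i \<in> {1..d} \<Longrightarrow> a i \<in> carrier G \<and> h (a i) = \<alpha> i"
      "\<And>i. i \<in> {1..d} \<Longrightarrow> b i \<in> carrier G \<and> h (b i) = \<beta> i"
  defines "A \<equiv> \<lambda>z. \<lambda>i\<in>{1..d}. f (fst (z i)) \<otimes> a i" and "B \<equiv> \<lambda>z. \<lambda>i\<in>{1..d}. f (snd (z i)) \<otimes> b i"
  shows "bij_betw (\<lambda>z. (A z, B z)) {z \<in> Q8_pairs d. commutator_prod G d (A z) (B z) = \<one>}
    (commutator_lifts G h d \<alpha> \<beta>)"
proof -
  have f_ker: "f x \<in> carrier G" "h (f x) = \<one>\<^bsub>H\<^esub>" if "x \<in> Q" for x
  proof -
    have "f x \<in> kernel G H h"
      using f(2) that by blast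
    then show "f x \<in> carrier G" "h (f x) = \<one>\<^bsub>H\<^esub>"
      by (auto simp: kernel_def)
  qed
  have f_inj: "x = y" if "f x = f y" "x \<in> Q" "y \<in> Q" for x y
    using f(1) that unfolding mon_def by (auto dest: inj_onD)
  have mem: "fst (z i) \<in> Q" "snd (z i) \<in> Q" if "z \<in> Q8_pairs d" "i \<in> {1..d}" for z i
    using that by (auto dest!: PiE_mem[of _ _ _ i])
  have quotient: "\<exists>x\<in>Q. g' = f x \<otimes> g" if "g \<in> carrier G" "g' \<in> carrier G" "h g' = h g" for g g'
  proof -
    have "g' \<otimes> inv g \<in> kernel G H h"
      using that by (simp add: kernel_def)
    then obtain x where "x \<in> Q" "f x = g' \<otimes> inv g"
      using f(2) by (metis (no_types, lifting) imageE)
    then show ?thesis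
      using that by (intro bexI[of _ x]) (auto simp: G.m_assoc)
  qed
  show ?thesis
    unfolding bij_betw_def
  proof (intro conjI inj_onI)
    fix z z' assume zz: "z \<in> {z \<in> Q8_pairs d. commutator_prod G d (A z) (B z) = \<one>}"
      "z' \<in> {z \<in> Q8_pairs d. commutator_prod G d (A z) (B z) = \<one>}" "(A z, B z) = (A z', B z')"
    then have z: "z \<in> Q8_pairs d" "z' \<in> Q8_pairs d"
      by auto
    show "z = z'"
    proof (rule PiE_ext[OF z])
      fix i assume i: "i \<in> {1..d}"
      have "A z i = A z' i" "B z i = B z' i"
        using zz(3) by auto
      then have "f (fst (z i)) = f (fst (z' i))" "f (snd (z i)) = f (snd (z' i))"
        using i lift f_ker mem[OF z(1) i] mem[OF z(2) i] by (simp_all add: A_def B_def)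
      then show "z i = z' i"
        using f_inj mem[OF z(1) i] mem[OF z(2) i] by (intro prod_eqI) auto
    qed
  next
    show "(\<lambda>z. (A z, B z)) ` {z \<in> Q8_pairs d. commutator_prod G d (A z) (B z) = \<one>} =
        commutator_lifts G h d \<alpha> \<beta>"
    proof (intro equalityI subsetI)
      fix p assume "p \<in> (\<lambda>z. (A z, B z)) ` {z \<in> Q8_pairs d. commutator_prod G d (A z) (B z) = \<one>}"
      then obtain z where z: "z \<in> Q8_pairs d" "commutator_prod G d (A z) (B z) = \<one>" "p = (A z, B z)"
        by blast
      have "A z i \<in> carrier G \<and> B z i \<in> carrier G \<and> h (A z i) = \<alpha> i \<and> h (B z i) = \<beta> i" if "i \<in> {1..d}" for i
        using that lift[OF that] hom_closed[of "a i"] hom_closed[of "b i"] f_ker mem[OF z(1) that]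
        by (simp add: A_def B_def)
      moreover have "A z \<in> extensional {1..d}" "B z \<in> extensional {1..d}"
        by (simp_all add: A_def B_def)
      ultimately show "p \<in> commutator_lifts G h d \<alpha> \<beta>"
        using z(2,3) unfolding commutator_lifts_def PiE_def by blast
    next
      fix p assume "p \<in> commutator_lifts G h d \<alpha> \<beta>"
      then obtain a' b' where p: "p = (a', b')" "a' \<in> {1..d} \<rightarrow>\<^sub>E carrier G" "b' \<in> {1..d} \<rightarrow>\<^sub>E carrier G"
          "\<forall>i\<in>{1..d}. h (a' i) = \<alpha> i \<and> h (b' i) = \<beta> i" "commutator_prod G d a' b' = \<one>"
        unfolding commutator_lifts_def by blast
      have "\<forall>i\<in>{1..d}. \<exists>x\<in>Q. a' i = f x \<otimes> a i" "\<forall>i\<in>{1..d}. \<exists>y\<in>Q. b' i = f y \<otimes> b i"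
        using p lift by (auto intro!: quotient)
      then obtain x y where xy: "\<forall>i\<in>{1..d}. x i \<in> Q \<and> a' i = f (x i) \<otimes> a i"
          "\<forall>i\<in>{1..d}. y i \<in> Q \<and> b' i = f (y i) \<otimes> b i"
        unfolding Bex_def by (metis (no_types, lifting) bchoice)
      define z where "z = (\<lambda>i\<in>{1..d}. (x i, y i))"
      have "z \<in> Q8_pairs d"
        using xy by (auto simp: z_def)
      moreover have "A z = a'" "B z = b'"
        using p(2,3) xy by (auto simp: A_def B_def z_def fun_eq_iff PiE_def extensional_def)
      ultimately show "p \<in> (\<lambda>z. (A z, B z)) ` {z \<in> Q8_pairs d. commutator_prod G d (A z) (B z) = \<one>}"
        using p by auto
    qed
  qed
qed

text \<open>The base product is some \<open>f s\<close>, so \<open>s\<close> and the quaternion word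
  act alike on \<open>Q8\<close> and differ by an integer scalar \<open>m\<close>. Membership in
  \<open>sym3\<close> forces \<open>s\<close> to be a sign. Other choices of lifts multiply both
  sides by the same \<open>x\<close>.\<close>

lemma (in Q8_normal_embedding) scaled_qcomm_word:
  assumes a: "\<And>i. i \<in> {1..d} \<Longrightarrow> u i \<in> sym3 \<and> intertwines (a i) (u i)"
    and b: "\<And>i. i \<in> {1..d} \<Longrightarrow> t i \<in> sym3 \<and> intertwines (b i) (t i)"
    and kernel: "commutator_prod G d a b \<in> f ` Q"
  defines "W \<equiv> \<lambda>z. commutator_prod G d (\<lambda>i\<in>{1..d}. f (fst (z i)) \<otimes> a i) (\<lambda>i\<in>{1..d}. f (snd (z i)) \<otimes> b i)"
  shows "\<exists>m w. scaled_qcomm_word d u t m w \<and> (\<forall>z\<in>Q8_pairs d. W z = f (w z))"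
proof -
  let ?W = "commutator_prod G d a b" and ?R = "prod_list (map (\<lambda>i. qcomm (u i) (t i)) [1..<Suc d])"
  have transl: "translates g r (f x \<otimes> g) (x * r)" if "intertwines g r" "x \<in> Q" for g r x
    using that unfolding translates_def by blast
  have W: "translates ?W ?R (W z) (qcomm_word d u t z)" if "z \<in> Q8_pairs d" for z
    unfolding W_def qcomm_word_def
  proof (rule translates_commutator_prod)
    fix i assume i: "i \<in> {1..d}"
    then have "fst (z i) \<in> Q" "snd (z i) \<in> Q"
      using that by (auto dest!: PiE_mem[of _ _ _ i])
    then show "translates (a i) (u i) ((\<lambda>i\<in>{1..d}. f (fst (z i)) \<otimes> a i) i) (fst (z i) * u i)"
      "translates (b i) (t i) ((\<lambda>i\<in>{1..d}. f (snd (z i)) \<otimes> b i) i) (snd (z i) * t i)"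
      using i a b by (auto intro: transl)
  qed
  let ?e = "\<lambda>i\<in>{1..d}. (1::quat, 1::quat)"
  have e: "?e \<in> Q8_pairs d"
    by auto
  have R: "intertwines ?W ?R"
    using W[OF e] unfolding translates_def by blast
  obtain s where s: "s \<in> Q" "?W = f s"
    using kernel by blast
  \<comment> \<open>Conjugation by \<open>s\<close> undoes that by \<open>?R\<close>, so the product
    centralizes \<open>Q8\<close> and is scalar.\<close>
  have "qcnj s * ?R * z = z * (qcnj s * ?R)" if z: "z \<in> Q" for z
  proof -
    obtain z' where z': "z' \<in> Q" "f s \<otimes> f z = f z' \<otimes> f s" "?R * z = z' * ?R"
      using intertwinesD(4)[OF R z] s by auto
    then have "s * z = z' * s"
      using s z by (intro f_inj) (auto simp: f_mult)
    then have "qcnj s * z' = z * qcnj s"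
      using qcnj_intertwines s(1) Q8_nonzero by blast
    then show ?thesis
      using z'(3) by (metis mult.assoc)
  qed
  then obtain m where "qcnj s * ?R = of_int m"
    using commutes_with_Q8_imp_scalar by blast
  then have "s * qcnj s * ?R = s * of_int m"
    by (simp only: mult.assoc)
  then have m: "?R = of_int m * s"
    by (simp add: Q8_mult_qcnj[OF s(1)] mult_of_int_commute)
  have m0: "m \<noteq> 0"
    using m intertwinesD(2)[OF R] by auto
  have "?R \<in> sym3"
    by (rule sym3_prod_qcomm) (use a b in auto)
  then have s_center: "s \<in> Q8_center"
    using sym3_Q8[OF s(1) m0] m by auto
  \<comment> \<open>On \<open>Q8_pairs d\<close> this is the genuine preimage, since
    \<open>key\<close> places \<open>W z\<close> in the image of the injective
    \<open>f\<close>.\<close>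
  define w where "w z = inv_into Q f (W z)" for z
  have w: "w z = x" if "W z = f x" "x \<in> Q" for z x
    using that f_mon unfolding w_def mon_def by (auto intro: inv_into_f_f)
  have key: "w z \<in> Q \<and> qcomm_word d u t z = of_int m * w z \<and> W z = f (w z)" if z: "z \<in> Q8_pairs d" for z
  proof -
    obtain x where x: "x \<in> Q" "W z = f x \<otimes> ?W" "qcomm_word d u t z = x * ?R"
      using W[OF z] unfolding translates_def by blast
    then have "W z = f (x * s)" "x * s \<in> Q"
      using s by (auto simp: f_mult)
    moreover have "qcomm_word d u t z = of_int m * (x * s)"
      unfolding x(3) m by (metis mult.assoc mult_of_int_commute)
    ultimately show ?thesis
      using w by simp
  qed
  have "W ?e = ?W"
    unfolding W_def
  proof (rule commutator_prod_cong)
    show "(\<lambda>i\<in>{1..d}. f (fst (?e i)) \<otimes> a i) i = a i" "(\<lambda>i\<in>{1..d}. f (snd (?e i)) \<otimes> b i) i = b i"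
      if "i \<in> {1..d}" for i
      using that intertwinesD(1)[OF conjunct2[OF a[OF that]]] intertwinesD(1)[OF conjunct2[OF b[OF that]]]
      by simp_all
  qed
  then have "w ?e = s"
    using w s by simp
  then have "scaled_qcomm_word d u t m w"
    using a b m0 key s_center by unfold_locales (auto dest: intertwinesD(3))
  then show ?thesis
    using key by blast
qed

text \<open>Both sides are 2 to the power 4d - 1.\<close>

lemma eight_power_mult_two_powi:
  assumes "d \<ge> 1"
  shows "(8::real) ^ (2 * d - 1) * 2 powi (2 - 2 * int d) = 16 ^ d / 2"
proof -
  obtain k where k: "d = Suc k"
    using assms by (cases d) auto
  have "(2::real) powi (2 - 2 * int d) = inverse (4 ^ k)"
  proof -
    have "2 - 2 * int d = - int (2 * k)"
      by (simp add: k)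
    then show ?thesis
      by (simp only: power_int_minus power_int_of_nat power_mult) simp
  qed
  moreover have "(8::real) ^ (2 * d - 1) = 8 * 64 ^ k"
    by (simp add: k power_mult)
  moreover have "(64::real) ^ k = 16 ^ k * 4 ^ k"
    by (simp flip: power_mult_distrib)
  ultimately show ?thesis
    by (simp add: k)
qed

theorem theorem5:
  fixes G :: "('g, 'm) monoid_scheme" and G' :: "('h, 'n) monoid_scheme"
    and f :: "quat \<Rightarrow> 'h" and q :: "'h \<Rightarrow> 'g"
    and d :: nat and \<alpha> \<beta> :: "nat \<Rightarrow> 'g"
  assumes "short_exact Q8 f G' q G"
    and "d \<ge> 2"
    and "\<And>i. i \<in> {1..d} \<Longrightarrow> \<alpha> i \<in> carrier G"
    and "\<And>i. i \<in> {1..d} \<Longrightarrow> \<beta> i \<in> carrier G"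
    and "commutator_prod G d \<alpha> \<beta> = \<one>\<^bsub>G\<^esub>"
  shows "(\<exists>a b. (a, b) \<in> commutator_lifts G' q d \<alpha> \<beta>) \<and>
         finite (commutator_lifts G' q d \<alpha> \<beta>) \<and>
         (\<exists>N\<in>{1, 2, 4 :: nat}. \<exists>\<epsilon>\<in>{1, -1 :: real}.
            real (card (commutator_lifts G' q d \<alpha> \<beta>)) =
              8 ^ (2 * d - 1) * (real N + \<epsilon> * 2 powi (2 - 2 * int d)))"
proof -
  have grp: "group G'" "group G" and f: "f \<in> mon Q8 G'" and q: "q \<in> hom G' G" "q ` carrier G' = carrier G"
    and ker: "f ` Q = kernel G' G q"
    using assms(1) unfolding short_exact_def epi_def by auto
  interpret q: group_hom G' G q
    using grp q by (intro group_hom.intro group_hom_axioms.intro)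
  have f_ker: "f z \<in> carrier G'" "q (f z) = \<one>\<^bsub>G\<^esub>" if "z \<in> Q" for z
  proof -
    have "f z \<in> kernel G' G q"
      using ker that by blast
    then show "f z \<in> carrier G'" "q (f z) = \<one>\<^bsub>G\<^esub>"
      by (auto simp: kernel_def)
  qed
  interpret Q8_normal_embedding G' f
  proof unfold_locales
    fix g z assume g: "g \<in> carrier G'" "z \<in> Q"
    then have "g \<otimes>\<^bsub>G'\<^esub> f z \<otimes>\<^bsub>G'\<^esub> inv\<^bsub>G'\<^esub> g \<in> kernel G' G q"
      using f_ker by (simp add: kernel_def)
    then obtain z' where "z' \<in> Q" "f z' = g \<otimes>\<^bsub>G'\<^esub> f z \<otimes>\<^bsub>G'\<^esub> inv\<^bsub>G'\<^esub> g"
      using ker by (metis (no_types, lifting) imageE)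
    then show "\<exists>z'\<in>Q. g \<otimes>\<^bsub>G'\<^esub> f z = f z' \<otimes>\<^bsub>G'\<^esub> g"
      using g f_ker by (intro bexI[of _ z']) (simp_all add: q.G.m_assoc)
  qed (rule f)
  \<comment> \<open>Replacing \<open>g\<close> by \<open>f e\<close> times \<open>g\<close> leaves
    its image under \<open>q\<close> unchanged and brings the intertwiner into
    \<open>sym3\<close>.\<close>
  have lift: "\<exists>g u. (g \<in> carrier G' \<and> q g = \<gamma>) \<and> u \<in> sym3 \<and> intertwines g u" if \<gamma>: "\<gamma> \<in> carrier G" for \<gamma>
  proof -
    obtain g where g: "g \<in> carrier G'" "q g = \<gamma>"
      using \<gamma> q(2) by (metis (no_types, lifting) imageE)
    obtain e u where "e \<in> Q" "u \<in> sym3" "intertwines (f e \<otimes>\<^bsub>G'\<^esub> g) u"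
      using ex_sym3_intertwiner[OF g(1)] by blast
    then show ?thesis
      using g f_ker \<gamma> by (intro exI[of _ "f e \<otimes>\<^bsub>G'\<^esub> g"] exI[of _ u]) auto
  qed
  obtain a u where a: "\<And>i. i \<in> {1..d} \<Longrightarrow> (a i \<in> carrier G' \<and> q (a i) = \<alpha> i) \<and> u i \<in> sym3 \<and> intertwines (a i) (u i)"
    using lift[OF assms(3)] by metis
  obtain b t where b: "\<And>i. i \<in> {1..d} \<Longrightarrow> (b i \<in> carrier G' \<and> q (b i) = \<beta> i) \<and> t i \<in> sym3 \<and> intertwines (b i) (t i)"
    using lift[OF assms(4)] by metis
  \<comment> \<open>The relation among the given elements of \<open>G\<close> puts the product of
    the base lifts into the kernel, that is, into the copy of \<open>Q8\<close>.\<close>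
  have "q (commutator_prod G' d a b) = commutator_prod G d \<alpha> \<beta>"
    using a b by (subst q.hom_commutator_prod) (auto intro: commutator_prod_cong)
  moreover have "commutator_prod G' d a b \<in> carrier G'"
    unfolding commutator_prod_def
    by (rule q.G.foldr_mult_closed) (use a b grp in \<open>auto intro!: commutator_closed\<close>)
  ultimately have "commutator_prod G' d a b \<in> f ` Q"
    using assms(5) unfolding ker kernel_def by simp
  then obtain m w where mw: "scaled_qcomm_word d u t m w"
    and w: "\<And>z. z \<in> Q8_pairs d \<Longrightarrow> commutator_prod G' d (\<lambda>i\<in>{1..d}. f (fst (z i)) \<otimes>\<^bsub>G'\<^esub> a i)
      (\<lambda>i\<in>{1..d}. f (snd (z i)) \<otimes>\<^bsub>G'\<^esub> b i) = f (w z)"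
    using scaled_qcomm_word[of d u a t b] a b by blast
  interpret S: scaled_qcomm_word d u t m w
    by (rule mw)
  have one: "f (w z) = \<one>\<^bsub>G'\<^esub> \<longleftrightarrow> w z = 1" if "z \<in> Q8_pairs d" for z
    using S.w_closed[OF that] f_inj[of "w z" 1] Q8_one f_one by auto
  have "{z \<in> Q8_pairs d. commutator_prod G' d (\<lambda>i\<in>{1..d}. f (fst (z i)) \<otimes>\<^bsub>G'\<^esub> a i)
      (\<lambda>i\<in>{1..d}. f (snd (z i)) \<otimes>\<^bsub>G'\<^esub> b i) = \<one>\<^bsub>G'\<^esub>} = {z \<in> Q8_pairs d. w z = 1}" (is "?L = ?S")
    using w one by auto
  moreover have "bij_betw (\<lambda>z. (\<lambda>i\<in>{1..d}. f (fst (z i)) \<otimes>\<^bsub>G'\<^esub> a i, \<lambda>i\<in>{1..d}. f (snd (z i)) \<otimes>\<^bsub>G'\<^esub> b i)) ?L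
      (commutator_lifts G' q d \<alpha> \<beta>)"
    using q.commutator_lifts_bij[OF f ker] a b by blast
  ultimately have card: "card (commutator_lifts G' q d \<alpha> \<beta>) = card ?S"
    and fin: "finite (commutator_lifts G' q d \<alpha> \<beta>)"
    using S.finite_P by (auto dest: bij_betw_same_card bij_betw_finite)
  have d: "d \<ge> 1"
    using assms(2) by simp
  obtain N :: nat and \<epsilon> :: int where N: "N \<in> {1, 2, 4}" and \<epsilon>: "\<epsilon> \<in> {1, -1}"
    and count: "2 * int (card ?S) = 2 * 8 ^ (2 * d - 1) * int N + \<epsilon> * 16 ^ d"
    using S.count[OF d] by (elim bexE) (rule that)
  have "real_of_int (2 * int (card ?S)) = 2 * 8 ^ (2 * d - 1) * real N + \<epsilon> * 16 ^ d"
    unfolding count by simp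
  moreover have "8 ^ (2 * d - 1) * (real N + \<epsilon> * 2 powi (2 - 2 * int d)) =
      8 ^ (2 * d - 1) * real N + \<epsilon> * (16 ^ d / 2)"
    using eight_power_mult_two_powi[OF d] by (simp only: distrib_left mult.left_commute)
  ultimately have eq: "real (card ?S) = 8 ^ (2 * d - 1) * (real N + \<epsilon> * 2 powi (2 - 2 * int d))"
    by simp
  \<comment> \<open>Existence follows from the count: \<open>d \<ge> 2\<close> bounds the correction
    by 1/4, while \<open>N\<close> is at least 1, so the number of families is positive.\<close>
  have "(2::real) powi (2 - 2 * int d) \<le> 2 powi (- 2)"
    using assms(2) by (intro power_int_increasing) auto
  also have "\<dots> = 1 / 4"
    by (simp add: power_int_minus)
  finally have "real N + \<epsilon> * 2 powi (2 - 2 * int d) > 0"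
    using N \<epsilon> by (auto simp: add_pos_pos)
  then have "card (commutator_lifts G' q d \<alpha> \<beta>) > 0"
    using eq card by (simp flip: of_nat_0_less_iff[where 'a = real])
  then have "commutator_lifts G' q d \<alpha> \<beta> \<noteq> {}"
    by auto
  moreover have "real_of_int \<epsilon> \<in> {1, -1}"
    using \<epsilon> by auto
  ultimately show ?thesis
    using fin N eq unfolding card[symmetric] by auto
qed

end
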